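(* For every link $L$, $$3\,t_C(L) - 2 \geq t(L).$$
   Context: Links are nonempty tame links in $S^3$, unoriented and considered up to ambient isotopy. Edge tiles. There are 11 edge tiles $T_0,\dots,T_{10}$, each a unit square carrying curves whose endpoints are midpoints of its sides: $T_0$ is empty; $T_1,T_2,T_3,T_4$ each carry a single arc joining the midpoints of two adjacent sides (respectively left/bottom, bottom/right, right/top, top/left); $T_5$ carries a segment joining the left and right midpoints; $T_6$ carries a segment joining the bottom and top midpoints; $T_7,T_8$ are the two tiles carrying two disjoint arcs, each joining midpoints of adjacent sides; $T_9,T_{10}$ carry the horizontal and the vertical segment crossing once at the center, with the two possible choices of over/under information. Edge mosaics. An edge mosaic is a finite rectangular grid of edge tiles such that every endpoint of a curve on a tile coincides with an endpoint of a curve on the edge-adjacent tile (in particular no endpoints lie on the outer boundary of the grid). It is thus a link diagram, and it represents the corresponding link. The edge tile number $t(L)$ is the minimum number of nonempty tiles (tiles other than $T_0$) in an edge mosaic representing $L$. Corner tiles. The pattern on each corner tile is the pattern on the corresponding edge tile rotated clockwise by $\pi/4$, with the curve endpoints now placed at corners of the square: $T_0$ is empty; $T_1,T_2,T_3,T_4$ carry a single arc joining the two left, the two bottom, the two right, the two top corners, respectively; $T_5$ carries a segment from upper-left to lower-right corner; $T_6$ carries a segment from lower-left to upper-right corner; $T_7,T_8$ are the two tiles carrying two disjoint arcs, each joining two adjacent corners; $T_9,T_{10}$ carry both diagonals crossing once at the center, with the two possible choices of over/under information. Corner mosaics. A corner mosaic is a finite rectangular grid of corner tiles such that every vertex of the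 grid is an endpoint of either no curve or exactly two curves on the tiles meeting at that vertex. It is thus a link diagram and represents the corresponding link. The corner tile number $t_C(L)$ is the minimum number of nonempty tiles in a corner mosaic representing $L$. *)

theory Defs
  imports "HOL-Analysis.Analysis"
begin

section \<open>Links in the three-sphere\<close>

text \<open>The three-sphere is the unit sphere of \<open>\<complex>\<^sup>2\<close>, whose product norm is the Euclidean one.
  Three-space is \<open>\<complex> \<times> \<real>\<close> (the plane of a diagram, and the height above it); it is
  identified with the complement of the point \<open>(0, \<i>)\<close> of the three-sphere by the inverse of
  the stereographic projection.\<close>

abbreviation S3 :: "(complex \<times> complex) set" where
  "S3 \<equiv> sphere 0 1"

definition stereo_inv :: "complex \<times> real \<Rightarrow> complex \<times> complex" where
  "stereo_inv = (\<lambda>(z, h). let s = (cmod z)\<^sup>2 + h\<^sup>2 in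
     (of_real (2 / (s + 1)) * z, Complex (2 * h / (s + 1)) ((s - 1) / (s + 1))))"

definition ambient_isotopic ::
    "(complex \<times> complex) set \<Rightarrow> (complex \<times> complex) set \<Rightarrow> bool" where
  "ambient_isotopic L L' \<longleftrightarrow>
     (\<exists>H :: real \<Rightarrow> complex \<times> complex \<Rightarrow> complex \<times> complex.
        continuous_on ({0..1} \<times> S3) (\<lambda>(t, x). H t x) \<and>
        (\<forall>t\<in>{0..1}. \<exists>G. homeomorphism S3 S3 (H t) G) \<and>
        (\<forall>x\<in>S3. H 0 x = x) \<and>
        H 1 ` L = L')"

definition polygonal :: "(complex \<times> real) set \<Rightarrow> bool" where
  "polygonal P \<longleftrightarrow> (\<exists>E. finite E \<and> P = (\<Union>(a, b)\<in>E. closed_segment a b))"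

definition tame :: "(complex \<times> complex) set \<Rightarrow> bool" where
  "tame L \<longleftrightarrow> (\<exists>P. polygonal P \<and> ambient_isotopic L (stereo_inv ` P))"

definition link :: "(complex \<times> complex) set \<Rightarrow> bool" where
  "link L \<longleftrightarrow> L \<subseteq> S3 \<and> tame L \<and>
     (\<exists>\<K>. finite \<K> \<and> \<K> \<noteq> {} \<and> pairwise disjnt \<K> \<and> L = \<Union>\<K> \<and>
        (\<forall>K\<in>\<K>. K homeomorphic sphere (0 :: complex) 1))"

section \<open>Tiles\<close>

datatype tile = T0 | T1 | T2 | T3 | T4 | T5 | T6 | T7 | T8 | T9 | T10

text \<open>The unit square is centred at the origin; the midpoints of its left, right, bottom and top
  sides are \<open>-1/2\<close>, \<open>1/2\<close>, \<open>-\<i>/2\<close> and \<open>\<i>/2\<close>.\<close>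

definition unit_square :: "complex set" where
  "unit_square = {z. \<bar>Re z\<bar> \<le> 1/2 \<and> \<bar>Im z\<bar> \<le> 1/2}"

fun edge_endpoints :: "tile \<Rightarrow> complex set" where
  "edge_endpoints T0 = {}"
| "edge_endpoints T1 = {-1/2, -\<i>/2}"
| "edge_endpoints T2 = {-\<i>/2, 1/2}"
| "edge_endpoints T3 = {1/2, \<i>/2}"
| "edge_endpoints T4 = {\<i>/2, -1/2}"
| "edge_endpoints T5 = {-1/2, 1/2}"
| "edge_endpoints T6 = {-\<i>/2, \<i>/2}"
| "edge_endpoints T7 = {-1/2, 1/2, -\<i>/2, \<i>/2}"
| "edge_endpoints T8 = {-1/2, 1/2, -\<i>/2, \<i>/2}"
| "edge_endpoints T9 = {-1/2, 1/2, -\<i>/2, \<i>/2}"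
| "edge_endpoints T10 = {-1/2, 1/2, -\<i>/2, \<i>/2}"

text \<open>If \<open>a\<close> and \<open>b\<close> are the midpoints of adjacent sides, then \<open>a + b\<close> is the corner that these
  sides share, and \<open>corner_arc a b\<close> is the quarter circle about this corner from \<open>a\<close> to \<open>b\<close>.\<close>

definition corner_arc :: "complex \<Rightarrow> complex \<Rightarrow> (complex \<times> real) set" where
  "corner_arc a b = {z \<in> unit_square. cmod (z - (a + b)) = 1/2} \<times> {0}"

definition flat_strand :: "complex \<Rightarrow> (complex \<times> real) set" where
  "flat_strand a = closed_segment (-a) a \<times> {0}"

text \<open>The over-strand of a crossing: it has height \<open>0\<close> at its endpoints and passes above the
  centre of the tile at height \<open>1/2\<close>.\<close>

definition over_strand :: "complex \<Rightarrow> (complex \<times> real) set" where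
  "over_strand a = (\<lambda>z. (z, 1/2 - cmod z)) ` closed_segment (-a) a"

fun edge_pattern :: "tile \<Rightarrow> (complex \<times> real) set" where
  "edge_pattern T0 = {}"
| "edge_pattern T1 = corner_arc (-1/2) (-\<i>/2)"
| "edge_pattern T2 = corner_arc (-\<i>/2) (1/2)"
| "edge_pattern T3 = corner_arc (1/2) (\<i>/2)"
| "edge_pattern T4 = corner_arc (\<i>/2) (-1/2)"
| "edge_pattern T5 = flat_strand (1/2)"
| "edge_pattern T6 = flat_strand (\<i>/2)"
| "edge_pattern T7 = corner_arc (-1/2) (-\<i>/2) \<union> corner_arc (1/2) (\<i>/2)"
| "edge_pattern T8 = corner_arc (-\<i>/2) (1/2) \<union> corner_arc (\<i>/2) (-1/2)"
| "edge_pattern T9 = over_strand (1/2) \<union> flat_strand (\<i>/2)"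
| "edge_pattern T10 = flat_strand (1/2) \<union> over_strand (\<i>/2)"

text \<open>Multiplication by \<open>1 - \<i>\<close> is the clockwise rotation by \<open>\<pi>/4\<close> followed by the scaling with
  \<open>sqrt 2\<close>; it takes the midpoints of the sides of the unit square to its corners.\<close>

definition corner_endpoints :: "tile \<Rightarrow> complex set" where
  "corner_endpoints \<tau> = (\<lambda>z. (1 - \<i>) * z) ` edge_endpoints \<tau>"

definition corner_pattern :: "tile \<Rightarrow> (complex \<times> real) set" where
  "corner_pattern \<tau> = (\<lambda>(z, h). ((1 - \<i>) * z, h)) ` edge_pattern \<tau>"

section \<open>Mosaics\<close>

text \<open>A grid with \<open>m\<close> columns and \<open>n\<close> rows of unit squares is given by \<open>M i j\<close> for \<open>i < m\<close> and
  \<open>j < n\<close>, where the square with index \<open>(i, j)\<close> is centred at \<open>i + j \<i>\<close>.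
  All other values of \<open>M\<close> are irrelevant.\<close>

definition centre :: "nat \<Rightarrow> nat \<Rightarrow> complex" where
  "centre i j = of_nat i + of_nat j * \<i>"

text \<open>The midpoint of a side of a square lies on no other square of the grid but the one across
  that side, so the square \<open>(i', j')\<close> below is edge-adjacent to \<open>(i, j)\<close>.\<close>

definition edge_mosaic :: "nat \<Rightarrow> nat \<Rightarrow> (nat \<Rightarrow> nat \<Rightarrow> tile) \<Rightarrow> bool" where
  "edge_mosaic m n M \<longleftrightarrow>
     (\<forall>i<m. \<forall>j<n. \<forall>p\<in>edge_endpoints (M i j).
        \<exists>i'<m. \<exists>j'<n. (i', j') \<noteq> (i, j) \<and>
          (\<exists>q\<in>edge_endpoints (M i' j'). centre i j + p = centre i' j' + q))"

text \<open>The vertices of the grid are the lower left corners of the squares \<open>(a, b)\<close> with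
  \<open>a \<le> m\<close> and \<open>b \<le> n\<close>. At most one curve of a tile ends at a given corner of it, so that the
  curves ending at a vertex correspond to the tiles counted here.\<close>

definition corner_mosaic :: "nat \<Rightarrow> nat \<Rightarrow> (nat \<Rightarrow> nat \<Rightarrow> tile) \<Rightarrow> bool" where
  "corner_mosaic m n M \<longleftrightarrow>
     (\<forall>a\<le>m. \<forall>b\<le>n.
        card {(i, j). i < m \<and> j < n \<and>
                (\<exists>p\<in>corner_endpoints (M i j). centre i j + p = centre a b - (1 + \<i>) / 2)}
          \<in> {0, 2})"

definition mosaic_curves ::
    "(tile \<Rightarrow> (complex \<times> real) set) \<Rightarrow> nat \<Rightarrow> nat \<Rightarrow> (nat \<Rightarrow> nat \<Rightarrow> tile) \<Rightarrow> (complex \<times> real) set" where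
  "mosaic_curves pattern m n M =
     (\<Union>i<m. \<Union>j<n. (\<lambda>(z, h). (centre i j + z, h)) ` pattern (M i j))"

definition tile_count :: "nat \<Rightarrow> nat \<Rightarrow> (nat \<Rightarrow> nat \<Rightarrow> tile) \<Rightarrow> nat" where
  "tile_count m n M = card {(i, j). i < m \<and> j < n \<and> M i j \<noteq> T0}"

text \<open>The infimum in the extended naturals is the minimum whenever some mosaic represents the
  link, and \<open>\<infinity>\<close> otherwise.\<close>

definition edge_tile_number :: "(complex \<times> complex) set \<Rightarrow> enat" where
  "edge_tile_number L =
     Inf {enat (tile_count m n M) | m n M.
            edge_mosaic m n M \<and>
            ambient_isotopic (stereo_inv ` mosaic_curves edge_pattern m n M) L}"

definition corner_tile_number :: "(complex \<times> complex) set \<Rightarrow> enat" where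
  "corner_tile_number L =
     Inf {enat (tile_count m n M) | m n M.
            corner_mosaic m n M \<and>
            ambient_isotopic (stereo_inv ` mosaic_curves corner_pattern m n M) L}"

end

theory Submission
  imports Defs
begin

text \<open>A corner mosaic with \<open>k\<close> nonempty tiles is turned into an edge mosaic of the same link with at
  most \<open>3 * k - 2\<close> nonempty tiles.

  Rotate the corner mosaic by \<open>\<pi>/4\<close> and scale it by \<open>sqrt 2\<close>. The pattern of a corner tile becomes
  the pattern of the corresponding edge tile, doubled in size. The centres of the tiles lie on one
  colour class of the checkerboard of unit squares, the vertices of the corner grid on the other.
  Shrink each doubled pattern to an edge tile, and keep its endpoints in place by straight stubs. At
  each vertex either no stub or exactly two stubs arrive, so that one of the tiles \<open>T0\<close> to \<open>T6\<close> in
  the square about the vertex can replace them. The result is an edge mosaic with one tile for each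
  nonempty corner tile and one for each vertex that is met by the curves (\<open>edge_mosaic_edge_grid\<close>,
  \<open>tile_count_edge\<close>).

  The number of these vertices is half the number of the endpoints on all tiles, and a tile has at
  most four endpoints. The rightmost tile of the top row has no curve that ends at its upper right
  corner, because no other tile could continue it; so this tile has only two endpoints. The same
  holds for the leftmost tile of the bottom row. Hence at most \<open>2 * k - 2\<close> vertices are met
  (\<open>sum_endpoints_le\<close>, \<open>tile_count_bound\<close>).

  For the ambient isotopy, the Alexander trick reduces the claim to the construction of a
  homeomorphism of three-space with bounded displacement that takes one set of curves to the other
  (\<open>ambient_isotopic_of_bounded_displacement\<close>). This homeomorphism is composed of one local move for
  each square (\<open>supported_move_UN\<close>). The local moves are made of shears: the two curves to be
  exchanged are graphs over the same line or plane, and the fibres are stretched so as to carry one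
  graph to the other (\<open>supported_move_shear\<close>). The rotation and the scaling are themselves isotopic to the identity
  (\<open>ambient_isotopic_affine\<close>).\<close>

section \<open>Isotopies of three-space and of the three-sphere\<close>

lemma ambient_isotopic_trans:
  assumes "ambient_isotopic X Y" and "ambient_isotopic Y Z"
  shows "ambient_isotopic X Z"
proof -
  obtain H1 :: "real \<Rightarrow> complex \<times> complex \<Rightarrow> complex \<times> complex" where
    H1: "continuous_on ({0..1} \<times> S3) (\<lambda>(t, x). H1 t x)"
      "\<And>t. t \<in> {0..1} \<Longrightarrow> \<exists>G. homeomorphism S3 S3 (H1 t) G"
      "\<And>x. x \<in> S3 \<Longrightarrow> H1 0 x = x" "H1 1 ` X = Y"
    using assms(1) unfolding ambient_isotopic_def by blast
  obtain H2 :: "real \<Rightarrow> complex \<times> complex \<Rightarrow> complex \<times> complex" where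
    H2: "continuous_on ({0..1} \<times> S3) (\<lambda>(t, x). H2 t x)"
      "\<And>t. t \<in> {0..1} \<Longrightarrow> \<exists>G. homeomorphism S3 S3 (H2 t) G"
      "\<And>x. x \<in> S3 \<Longrightarrow> H2 0 x = x" "H2 1 ` Y = Z"
    using assms(2) unfolding ambient_isotopic_def by blast
  define H where "H = (\<lambda>t x. if t \<le> 1/2 then H1 (2 * t) x else H2 (2 * t - 1) (H1 1 x))"
  have maps1: "H1 t x \<in> S3" if "t \<in> {0..1}" "x \<in> S3" for t x
    using H1(2)[OF that(1)] that(2) unfolding homeomorphism_def by blast
  have cont1: "continuous_on A (\<lambda>a. H1 (u a) (v a))"
    if "continuous_on A u" "continuous_on A v" "\<And>a. a \<in> A \<Longrightarrow> u a \<in> {0..1} \<and> v a \<in> S3"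
    for A :: "(real \<times> complex \<times> complex) set" and u v
    using continuous_on_compose2[OF H1(1) continuous_on_Pair[OF that(1,2)]] that(3)
    by (fastforce simp: image_subset_iff)
  have cont2: "continuous_on A (\<lambda>a. H2 (u a) (v a))"
    if "continuous_on A u" "continuous_on A v" "\<And>a. a \<in> A \<Longrightarrow> u a \<in> {0..1} \<and> v a \<in> S3"
    for A :: "(real \<times> complex \<times> complex) set" and u v
    using continuous_on_compose2[OF H2(1) continuous_on_Pair[OF that(1,2)]] that(3)
    by (fastforce simp: image_subset_iff)
  have "continuous_on ({0..1} \<times> S3)
      (\<lambda>a. if fst a \<le> 1/2 then H1 (2 * fst a) (snd a) else H2 (2 * fst a - 1) (H1 1 (snd a)))"
  proof (rule continuous_on_cases_le)
    show "continuous_on {x \<in> {0..1} \<times> S3. fst x \<le> 1 / 2} (\<lambda>x. H1 (2 * fst x) (snd x))"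
      by (rule cont1) (auto intro!: continuous_intros)
    have "continuous_on {x \<in> {0..1::real} \<times> S3. 1 / 2 \<le> fst x} (\<lambda>x. H1 1 (snd x))"
      by (rule cont1) (auto intro!: continuous_intros)
    then show "continuous_on {x \<in> {0..1} \<times> S3. 1 / 2 \<le> fst x} (\<lambda>x. H2 (2 * fst x - 1) (H1 1 (snd x)))"
      by (intro cont2) (use maps1 in \<open>auto intro!: continuous_intros\<close>)
    fix a :: "real \<times> complex \<times> complex" assume "a \<in> {0..1} \<times> S3" "fst a = 1/2"
    then have "2 * fst a = 1" "snd a \<in> S3" by auto
    then show "H1 (2 * fst a) (snd a) = H2 (2 * fst a - 1) (H1 1 (snd a))"
      using H2(3)[OF maps1[of 1 "snd a"]] by (simp del: mem_sphere_0)
  qed (auto intro!: continuous_intros)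
  then have "continuous_on ({0..1} \<times> S3) (\<lambda>(t, x). H t x)"
    by (simp add: H_def case_prod_unfold)
  moreover have "\<exists>G. homeomorphism S3 S3 (H t) G" if t: "t \<in> {0..1}" for t
  proof (cases "t \<le> 1/2")
    case True
    then show ?thesis using H1(2)[of "2 * t"] t by (auto simp: H_def)
  next
    case False
    obtain G1 G2 where "homeomorphism S3 S3 (H1 1) G1" "homeomorphism S3 S3 (H2 (2 * t - 1)) G2"
      using H1(2)[of 1] H2(2)[of "2 * t - 1"] t False by auto
    then have "homeomorphism S3 S3 (H2 (2 * t - 1) \<circ> H1 1) (G1 \<circ> G2)"
      by (rule homeomorphism_compose)
    moreover have "H t = H2 (2 * t - 1) \<circ> H1 1"
      using False by (auto simp: H_def)
    ultimately show ?thesis by auto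
  qed
  moreover have "H 0 x = x" if "x \<in> S3" for x
    using H1(3)[OF that] by (simp add: H_def)
  moreover have "H 1 ` X = Z"
    using H1(4) H2(4) by (auto simp: H_def image_image)
  ultimately show ?thesis
    unfolding ambient_isotopic_def by blast
qed

text \<open>The point at infinity of three-space.\<close>

definition pole :: "complex \<times> complex" where
  "pole = (0, \<i>)"

text \<open>The stereographic projection, inverse to \<open>stereo_inv\<close> away from \<open>pole\<close>.\<close>

definition stereo :: "complex \<times> complex \<Rightarrow> complex \<times> real" where
  "stereo = (\<lambda>(z, w). (z / of_real (1 - Im w), Re w / (1 - Im w)))"

lemma sum_of_squares_eq_norm: "(cmod z)\<^sup>2 + h\<^sup>2 = (norm (z, h :: real))\<^sup>2"
  by (simp add: norm_Pair)

lemma stereo_inv_eq: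
  "stereo_inv p = (of_real (2 / ((norm p)\<^sup>2 + 1)) * fst p,
     Complex (2 * snd p / ((norm p)\<^sup>2 + 1)) (((norm p)\<^sup>2 - 1) / ((norm p)\<^sup>2 + 1)))"
  by (cases p) (simp add: stereo_inv_def Let_def sum_of_squares_eq_norm)

lemma denominator_pos: "(norm (p :: complex \<times> real))\<^sup>2 + 1 > 0"
  by (smt (verit) zero_le_power2)

lemma norm_stereo_inv: "norm (stereo_inv p) = 1"
proof -
  obtain z h where p: "p = (z, h)" by fastforce
  define s where "s = (norm p)\<^sup>2"
  have s: "s + 1 > 0" using denominator_pos[of p] by (simp add: s_def)
  have zh: "(cmod z)\<^sup>2 = s - h\<^sup>2" by (simp add: s_def p norm_Pair)
  have "(norm (stereo_inv p))\<^sup>2 = (2 / (s + 1))\<^sup>2 * (cmod z)\<^sup>2 + (2 * h / (s + 1))\<^sup>2 + ((s - 1) / (s + 1))\<^sup>2"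
    unfolding stereo_inv_eq s_def[symmetric] unfolding p using s
    by (simp add: norm_Pair complex_norm norm_mult norm_divide power_mult_distrib
        power_divide del: of_real_divide of_real_add)
  also have "\<dots> = 1"
    unfolding zh using s by (simp add: divide_simps power2_eq_square) (simp add: algebra_simps)
  finally show ?thesis
    by (metis norm_ge_zero one_power2 power2_eq_imp_eq zero_le_one)
qed

lemma stereo_inv_in_sphere: "stereo_inv p \<in> S3"
  by (simp add: norm_stereo_inv)

lemma stereo_inv_neq_pole: "stereo_inv p \<noteq> pole"
  using denominator_pos[of p] by (auto simp: stereo_inv_eq pole_def complex_eq_iff divide_simps)

lemma stereo_stereo_inv: "stereo (stereo_inv p) = p"
proof -
  have "1 - ((norm p)\<^sup>2 - 1) / ((norm p)\<^sup>2 + 1) = 2 / ((norm p)\<^sup>2 + 1)"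
    using denominator_pos[of p] by (simp add: field_simps)
  then show ?thesis
    using denominator_pos[of p]
    by (cases p) (simp add: stereo_def stereo_inv_eq complex_eq_iff del: of_real_divide)
qed

lemma Im_less_1:
  assumes "x \<in> S3" "x \<noteq> pole"
  shows "Im (snd x) < 1"
proof -
  obtain z w where x: "x = (z, w)" by fastforce
  have eq: "(cmod z)\<^sup>2 + (Re w)\<^sup>2 + (Im w)\<^sup>2 = 1"
    using assms(1) by (simp add: x norm_Pair cmod_power2)
  show ?thesis
  proof (rule ccontr)
    assume "\<not> Im (snd x) < 1"
    then have "(Im w)\<^sup>2 \<ge> 1" by (simp add: x)
    then have "(cmod z)\<^sup>2 + (Re w)\<^sup>2 \<le> 0" using eq by simp
    then have "z = 0" "Re w = 0" by (auto simp: sum_power2_le_zero_iff)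
    moreover have "Im w = 1"
      using eq calculation \<open>\<not> Im (snd x) < 1\<close> by (simp add: power2_eq_1_iff x)
    ultimately show False using assms(2) by (simp add: x pole_def complex_eq_iff)
  qed
qed

lemma norm_stereo:
  assumes "x \<in> S3" "x \<noteq> pole"
  shows "(norm (stereo x))\<^sup>2 + 1 = 2 / (1 - Im (snd x))"
proof -
  obtain z w where x: "x = (z, w)" by fastforce
  have eq: "(cmod z)\<^sup>2 = 1 - (Re w)\<^sup>2 - (Im w)\<^sup>2"
    using assms(1) by (simp add: x norm_Pair cmod_power2)
  have pos: "1 - Im w > 0" using Im_less_1[OF assms] by (simp add: x)
  have "(norm (stereo x))\<^sup>2 = (cmod z)\<^sup>2 / (1 - Im w)\<^sup>2 + (Re w)\<^sup>2 / (1 - Im w)\<^sup>2"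
    using pos by (simp add: x stereo_def norm_Pair norm_divide power_divide del: of_real_diff)
  also have "\<dots> = ((1 - Im w) * (1 + Im w)) / (1 - Im w)\<^sup>2"
    unfolding eq add_divide_distrib[symmetric] by (simp add: power2_eq_square algebra_simps)
  also have "\<dots> = (1 + Im w) / (1 - Im w)"
    using pos by (simp add: power2_eq_square)
  finally show ?thesis
    using pos by (simp add: x field_simps)
qed

lemma stereo_inv_stereo:
  assumes "x \<in> S3" "x \<noteq> pole"
  shows "stereo_inv (stereo x) = x"
proof -
  obtain z w where x: "x = (z, w)" by fastforce
  have pos: "1 - Im w > 0" using Im_less_1[OF assms] by (simp add: x)
  have n: "(norm (stereo x))\<^sup>2 + 1 = 2 / (1 - Im w)"
    using norm_stereo[OF assms] by (simp add: x)
  have n': "(norm (stereo x))\<^sup>2 - 1 = 2 / (1 - Im w) - 2"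
    using n by simp
  show ?thesis
    unfolding stereo_inv_eq n n' using pos
    by (simp add: x stereo_def complex_eq_iff field_simps)
qed

lemma dist_pole:
  assumes "x \<in> S3"
  shows "(dist x pole)\<^sup>2 = 2 * (1 - Im (snd x))"
proof -
  obtain z w where x: "x = (z, w)" by fastforce
  have eq: "(cmod z)\<^sup>2 + (Re w)\<^sup>2 + (Im w)\<^sup>2 = 1"
    using assms(1) by (simp add: x norm_Pair cmod_power2)
  have "(dist w \<i>)\<^sup>2 = (Re w)\<^sup>2 + (Im w - 1)\<^sup>2"
    by (simp add: dist_norm cmod_power2)
  then have "(dist x pole)\<^sup>2 = (cmod z)\<^sup>2 + ((Re w)\<^sup>2 + (Im w - 1)\<^sup>2)"
    by (simp add: x pole_def dist_Pair_Pair)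
  then show ?thesis using eq by (simp add: x power2_eq_square algebra_simps)
qed

text \<open>The chordal distance to \<open>pole\<close> depends only on the norm of the projected point. This turns
  properness of maps of three-space into continuity at \<open>pole\<close>.\<close>

lemma dist_pole_stereo:
  assumes "x \<in> S3" "x \<noteq> pole"
  shows "(dist x pole)\<^sup>2 * ((norm (stereo x))\<^sup>2 + 1) = 4"
  using Im_less_1[OF assms] unfolding dist_pole[OF assms(1)] norm_stereo[OF assms]
  by (simp add: field_simps)

lemma continuous_on_stereo_inv: "continuous_on A stereo_inv"
proof -
  have eq: "stereo_inv = (\<lambda>p. (of_real (2 / ((norm p)\<^sup>2 + 1)) * fst p,
     of_real (2 * snd p / ((norm p)\<^sup>2 + 1)) + \<i> * of_real (((norm p)\<^sup>2 - 1) / ((norm p)\<^sup>2 + 1))))"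
    unfolding stereo_inv_eq Complex_eq by simp
  have "(norm p)\<^sup>2 + 1 \<noteq> 0" for p :: "complex \<times> real"
    using denominator_pos[of p] by simp
  then show ?thesis
    unfolding eq by (intro continuous_intros) auto
qed

lemma continuous_on_stereo: "continuous_on (S3 - {pole}) stereo"
  unfolding stereo_def case_prod_unfold
  using Im_less_1 by (intro continuous_intros) (force simp: complex_eq_iff)+

text \<open>A family of homeomorphisms of three-space that is proper uniformly in time extends
  continuously to the point at infinity, so it induces an isotopy of the three-sphere.\<close>

lemma ambient_isotopic_of_proper_family:
  fixes F :: "real \<Rightarrow> complex \<times> real \<Rightarrow> complex \<times> real"
  assumes cont: "continuous_on ({0..1} \<times> UNIV) (\<lambda>(t, p). F t p)"
    and bij: "\<And>t. t \<in> {0..1} \<Longrightarrow> bij (F t)"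
    and start: "\<And>p. F 0 p = p"
    and proper: "\<And>R. \<exists>R'. \<forall>t\<in>{0..1}. \<forall>p. norm p \<ge> R' \<longrightarrow> norm (F t p) \<ge> R"
    and target: "F 1 ` X = Y"
  shows "ambient_isotopic (stereo_inv ` X) (stereo_inv ` Y)"
proof -
  define H where "H = (\<lambda>t x. if x = pole then pole else stereo_inv (F t (stereo x)))"
  have pole: "pole \<in> S3" by (simp add: pole_def norm_Pair)
  have maps: "H t x \<in> S3" if "x \<in> S3" for t x
    using that stereo_inv_in_sphere pole by (auto simp: H_def)
  have away: "continuous_on ({0..1} \<times> (S3 - {pole})) (\<lambda>(t, x). H t x)"
  proof -
    have "continuous_on ({0..1} \<times> (S3 - {pole})) (\<lambda>a. stereo (snd a))"
      by (rule continuous_on_compose2[OF continuous_on_stereo]) (auto intro!: continuous_intros)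
    then have "continuous_on ({0..1} \<times> (S3 - {pole})) (\<lambda>a. (fst a, stereo (snd a)))"
      by (intro continuous_intros)
    then have "continuous_on ({0..1} \<times> (S3 - {pole})) (\<lambda>a. F (fst a) (stereo (snd a)))"
      using continuous_on_compose2[OF cont, of "{0..1} \<times> (S3 - {pole})" "\<lambda>a. (fst a, stereo (snd a))"]
      by (simp add: image_subset_iff del: mem_sphere_0)
    then have "continuous_on ({0..1} \<times> (S3 - {pole})) (\<lambda>a. stereo_inv (F (fst a) (stereo (snd a))))"
      by (rule continuous_on_compose2[OF continuous_on_stereo_inv]) auto
    then show ?thesis
      by (rule continuous_on_eq) (simp add: H_def case_prod_unfold mem_Times_iff)
  qed
  have "continuous (at a within {0..1} \<times> S3) (\<lambda>(t, x). H t x)" if a: "a \<in> {0..1} \<times> S3" for a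
  proof (cases "snd a = pole")
    case False
    have "open (UNIV \<times> (- {pole}) :: (real \<times> complex \<times> complex) set)"
      by (intro open_Times) auto
    then have "at a within {0..1} \<times> S3 = at a within {0..1} \<times> (S3 - {pole})"
      using False by (intro at_within_nhd[of _ "UNIV \<times> (- {pole})"]) (auto simp: mem_Times_iff)
    moreover have "a \<in> {0..1} \<times> (S3 - {pole})" using a False by (auto simp: mem_Times_iff)
    ultimately show ?thesis
      using away by (metis continuous_on_eq_continuous_within)
  next
    case True
    have val: "(\<lambda>(t, x). H t x) a = pole" using True by (simp add: H_def case_prod_unfold)
    show ?thesis
      unfolding continuous_within_eps_delta val
    proof (intro allI impI)
      fix e :: real assume e: "e > 0"
      obtain R' where R': "\<And>t p. t \<in> {0..1} \<Longrightarrow> norm p \<ge> R' \<Longrightarrow> norm (F t p) \<ge> 2 / e"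
        using proper[of "2 / e"] by blast
      \<comment> \<open>The chordal distance that corresponds to the norm \<open>max R' 0\<close>.\<close>
      define d where "d = 2 / sqrt ((max R' 0)\<^sup>2 + 1)"
      have d0: "(max R' 0)\<^sup>2 + 1 > 0" by (smt (verit) zero_le_power2)
      have d: "d > 0" "d\<^sup>2 * ((max R' 0)\<^sup>2 + 1) = 4"
        using d0 by (auto simp: d_def power_divide field_simps)
      have "dist ((\<lambda>(t, x). H t x) b) pole < e" if b: "b \<in> {0..1} \<times> S3" "dist b a < d" for b
      proof (cases "snd b = pole")
        case True
        then show ?thesis using e by (simp add: H_def case_prod_unfold)
      next
        case False
        let ?x = "snd b"
        have x: "?x \<in> S3" "?x \<noteq> pole" "fst b \<in> {0..1}" using b False by auto
        have "dist ?x pole \<le> dist b a" using True dist_snd_le[of b a] by simp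
        then have "(dist ?x pole)\<^sup>2 < d\<^sup>2" using b(2) by (intro power_strict_mono) auto
        then have "(norm (stereo ?x))\<^sup>2 + 1 > (max R' 0)\<^sup>2 + 1"
          using dist_pole_stereo[OF x(1,2)] d d0
          by (smt (verit) mult_less_cancel_right mult_left_mono zero_le_power2)
        then have "(max R' 0)\<^sup>2 \<le> (norm (stereo ?x))\<^sup>2" by linarith
        then have "max R' 0 \<le> norm (stereo ?x)" by (rule power2_le_imp_le[OF _ norm_ge_zero])
        then have far: "norm (F (fst b) (stereo ?x)) \<ge> 2 / e" using R' x(3) by simp
        define y where "y = H (fst b) ?x"
        have y: "y = stereo_inv (F (fst b) (stereo ?x))" using False by (simp add: y_def H_def)
        have yS: "y \<in> S3" "y \<noteq> pole" unfolding y by (rule stereo_inv_in_sphere stereo_inv_neq_pole)+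
        have "(dist y pole)\<^sup>2 * ((norm (F (fst b) (stereo ?x)))\<^sup>2 + 1) = 4"
          using dist_pole_stereo[OF yS] by (simp add: y stereo_stereo_inv)
        moreover have "(norm (F (fst b) (stereo ?x)))\<^sup>2 + 1 > (2 / e)\<^sup>2"
          using power_mono[OF far, of 2] e by (smt (verit) divide_nonneg_pos)
        moreover have "dist y pole > 0" using yS by simp
        ultimately have "(dist y pole)\<^sup>2 * (2 / e)\<^sup>2 < 4"
          by (smt (verit) mult_strict_left_mono zero_less_power)
        then have "(dist y pole)\<^sup>2 < e\<^sup>2" using e by (simp add: power_divide field_simps)
        then have "dist y pole < e" using e by (simp add: power_less_imp_less_base)
        then show ?thesis by (simp add: y_def case_prod_unfold)
      qed
      then show "\<exists>d>0. \<forall>b\<in>{0..1} \<times> S3. dist b a < d \<longrightarrow> dist ((\<lambda>(t, x). H t x) b) pole < e"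
        using d(1) by blast
    qed
  qed
  then have contH: "continuous_on ({0..1} \<times> S3) (\<lambda>(t, x). H t x)"
    by (simp add: continuous_on_eq_continuous_within)
  moreover have "\<exists>G. homeomorphism S3 S3 (H t) G" if t: "t \<in> {0..1}" for t
  proof (rule homeomorphism_compact)
    show "continuous_on S3 (H t)"
      using continuous_on_compose2[OF contH, of S3 "\<lambda>x. (t, x)"] t
      by (simp add: image_subset_iff continuous_on_Pair continuous_on_const continuous_on_id del: mem_sphere_0)
    show "inj_on (H t) S3"
      unfolding H_def inj_on_def
      by (metis bij bij_is_inj inj_eq stereo_inv_neq_pole stereo_inv_stereo stereo_stereo_inv t)
    show "H t ` S3 = S3"
    proof (intro subset_antisym subsetI)
      fix y assume "y \<in> H t ` S3" then show "y \<in> S3" using maps by blast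
    next
      fix y assume y: "y \<in> S3"
      show "y \<in> H t ` S3"
      proof (cases "y = pole")
        case True
        then show ?thesis using pole by (auto simp: H_def image_iff)
      next
        case False
        obtain p where p: "F t p = stereo y" using bij[OF t] by (metis bij_pointE)
        have "H t (stereo_inv p) = y"
          using p False y by (simp add: H_def stereo_inv_neq_pole stereo_stereo_inv stereo_inv_stereo)
        then show ?thesis using stereo_inv_in_sphere by blast
      qed
    qed
  qed simp
  moreover have "H 0 x = x" if "x \<in> S3" for x
    using that by (auto simp: H_def start stereo_inv_stereo)
  moreover have "H 1 ` stereo_inv ` X = stereo_inv ` Y"
    unfolding target[symmetric] image_image
    by (auto simp: H_def stereo_inv_neq_pole stereo_stereo_inv)
  ultimately show ?thesis
    unfolding ambient_isotopic_def by blast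
qed

text \<open>The Alexander trick: conjugating a homeomorphism of bounded displacement with the scaling by
  \<open>t\<close> multiplies the displacement by \<open>t\<close>, so these conjugates tend to the identity for
  \<open>t \<rightarrow> 0\<close>.\<close>

lemma ambient_isotopic_of_bounded_displacement:
  fixes f g :: "complex \<times> real \<Rightarrow> complex \<times> real"
  assumes contf: "continuous_on UNIV f"
    and gf: "\<And>x. g (f x) = x" and fg: "\<And>x. f (g x) = x"
    and bound: "\<And>x. dist (f x) x \<le> B"
    and target: "f ` X = Y"
  shows "ambient_isotopic (stereo_inv ` X) (stereo_inv ` Y)"
proof -
  \<comment> \<open>The value at \<open>t = 0\<close> is the limit, since \<open>F t\<close> moves no point by more than \<open>t * B\<close>.\<close>
  define F where "F = (\<lambda>t p. if t = 0 then p else t *\<^sub>R f (p /\<^sub>R t))"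
  have B: "B \<ge> 0" using bound zero_le_dist order_trans by blast
  have disp: "dist (F t p) p \<le> \<bar>t\<bar> * B" for t p
  proof (cases "t = 0")
    case False
    have "dist (t *\<^sub>R f (p /\<^sub>R t)) p = dist (t *\<^sub>R f (p /\<^sub>R t)) (t *\<^sub>R (p /\<^sub>R t))"
      using False by simp
    also have "\<dots> = \<bar>t\<bar> * dist (f (p /\<^sub>R t)) (p /\<^sub>R t)"
      by (simp only: dist_norm norm_scaleR[symmetric] scaleR_diff_right)
    also have "\<dots> \<le> \<bar>t\<bar> * B" using bound by (simp add: mult_left_mono)
    finally show ?thesis using False by (simp add: F_def)
  qed (simp add: F_def)
  have "continuous (at a within {0..1} \<times> UNIV) (\<lambda>(t, p). F t p)" if a: "a \<in> {0..1} \<times> UNIV"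
    for a :: "real \<times> complex \<times> real"
  proof (cases "fst a = 0")
    case False
    have op: "open ((- {0}) \<times> UNIV :: (real \<times> complex \<times> real) set)"
      by (intro open_Times) auto
    have "continuous_on ((- {0}) \<times> UNIV) (\<lambda>b. fst b *\<^sub>R f (snd b /\<^sub>R fst b))"
      by (intro continuous_intros continuous_on_compose2[OF contf]) auto
    then have "continuous_on ((- {0}) \<times> UNIV) (\<lambda>(t, p). F t p)"
      by (rule continuous_on_eq) (simp add: F_def case_prod_unfold mem_Times_iff)
    then have "\<forall>b\<in>(- {0 :: real}) \<times> (UNIV :: (complex \<times> real) set). isCont (\<lambda>(t, p). F t p) b"
      by (simp only: continuous_on_eq_continuous_at[OF op])
    then have "isCont (\<lambda>(t, p). F t p) a"
      by (rule bspec) (use False in \<open>simp add: mem_Times_iff\<close>)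
    then show ?thesis by (rule continuous_at_imp_continuous_within)
  next
    case True
    then have val: "(\<lambda>(t, p). F t p) a = snd a" by (simp add: F_def case_prod_unfold)
    show ?thesis
      unfolding continuous_within_eps_delta val
    proof (intro allI impI)
      fix e :: real assume e: "e > 0"
      define d where "d = e / (B + 1)"
      have "dist ((\<lambda>(t, p). F t p) b) (snd a) < e" if "dist b a < d" for b
      proof -
        have "\<bar>fst b\<bar> \<le> dist b a"
          using dist_fst_le[of b a] True by (simp add: dist_real_def)
        then have *: "\<bar>fst b\<bar> * B \<le> dist b a * B" using B by (simp add: mult_right_mono)
        have "dist (F (fst b) (snd b)) (snd a) \<le> dist (F (fst b) (snd b)) (snd b) + dist (snd b) (snd a)"
          by (rule dist_triangle)
        also have "\<dots> \<le> dist b a * B + dist b a"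
          using disp[of "fst b" "snd b"] dist_snd_le[of b a] * by linarith
        also have "\<dots> = dist b a * (B + 1)" by (simp add: algebra_simps)
        also have "\<dots> < e" using that B by (simp add: d_def field_simps)
        finally show ?thesis by (simp add: case_prod_unfold)
      qed
      then show "\<exists>d>0. \<forall>b\<in>{0..1} \<times> UNIV. dist b a < d \<longrightarrow> dist ((\<lambda>(t, p). F t p) b) (snd a) < e"
        using e B by (intro exI[of _ d]) (auto simp: d_def)
    qed
  qed
  then have "continuous_on ({0..1} \<times> UNIV) (\<lambda>(t, p). F t p)"
    by (simp add: continuous_on_eq_continuous_within)
  moreover have "bij (F t)" if "t \<in> {0..1}" for t
  proof (cases "t = 0")
    case True
    then show ?thesis by (simp add: F_def bij_iff)
  next
    case False
    then show ?thesis
      by (intro o_bij[of "\<lambda>p. t *\<^sub>R g (p /\<^sub>R t)"]) (auto simp: F_def fun_eq_iff fg gf)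
  qed
  moreover have "\<exists>R'. \<forall>t\<in>{0..1}. \<forall>p. norm p \<ge> R' \<longrightarrow> norm (F t p) \<ge> R" for R
  proof (intro exI[of _ "R + B"] ballI allI impI)
    fix t :: real and p :: "complex \<times> real" assume t: "t \<in> {0..1}" and p: "norm p \<ge> R + B"
    have "\<bar>t\<bar> * B \<le> B" using t B by (simp add: mult_left_le_one_le)
    then have "norm (F t p - p) \<le> B" using disp[of t p] by (simp add: dist_norm)
    then show "norm (F t p) \<ge> R" using p norm_triangle_ineq2[of p "p - F t p"]
      by (simp add: norm_minus_commute)
  qed
  moreover have "F 1 ` X = Y" using target by (simp add: F_def)
  ultimately show ?thesis
    by (intro ambient_isotopic_of_proper_family[of F]) (auto simp: F_def)
qed

text \<open>Since \<open>a\<close> has a logarithm \<open>w\<close>, the maps \<open>z \<mapsto> exp (t * w) * z + t * b\<close> join the identity to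
  the given one; they are proper uniformly in \<open>t\<close> because \<open>exp (- (t * w))\<close> is bounded.\<close>

lemma ambient_isotopic_affine:
  assumes "a \<noteq> 0"
  shows "ambient_isotopic (stereo_inv ` X) (stereo_inv ` (\<lambda>(z, h). (a * z + b, h)) ` X)"
proof -
  define w where "w = Ln a"
  define F where "F = (\<lambda>(t::real) (p::complex \<times> real). (exp (of_real t * w) * fst p + of_real t * b, snd p))"
  have w: "exp w = a" using assms by (simp add: w_def)
  have "continuous_on ({0..1} \<times> UNIV) (\<lambda>(t, p). F t p)"
    unfolding F_def case_prod_unfold by (intro continuous_intros)
  moreover have "bij (F t)" for t
    by (intro o_bij[of "\<lambda>p. ((fst p - of_real t * b) / exp (of_real t * w), snd p)"])
      (auto simp: F_def fun_eq_iff)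
  moreover have "\<exists>R'. \<forall>t\<in>{0..1}. \<forall>p. norm p \<ge> R' \<longrightarrow> norm (F t p) \<ge> R" for R
  proof -
    have "norm (F t p) \<ge> R"
      if t: "t \<in> {0..1}" and p: "norm p \<ge> exp (norm w) * (R + norm b) + R" for t p
    proof -
      have "cmod (exp (- (of_real t * w))) \<le> exp (cmod (- (of_real t * w)))" by (rule norm_exp)
      also have "\<dots> \<le> exp (cmod w)" using t by (simp add: norm_mult mult_left_le_one_le)
      finally have e: "cmod (exp (- (of_real t * w))) \<le> exp (cmod w)" .
      have tb: "cmod (of_real t * b) \<le> cmod b" using t by (simp add: norm_mult mult_left_le_one_le)
      have n1: "cmod (fst (F t p)) \<le> norm (F t p)" using norm_fst_le[of "fst (F t p)" "snd (F t p)"] by simp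
      have n2: "\<bar>snd (F t p)\<bar> \<le> norm (F t p)" using norm_snd_le[of "snd (F t p)" "fst (F t p)"] by simp
      have "fst p = exp (- (of_real t * w)) * (fst (F t p) - of_real t * b)"
        by (simp add: F_def exp_minus)
      then have "cmod (fst p) = cmod (exp (- (of_real t * w))) * cmod (fst (F t p) - of_real t * b)"
        by (metis norm_mult)
      also have "\<dots> \<le> exp (cmod w) * (norm (F t p) + cmod b)"
        using e tb n1 norm_triangle_ineq4[of "fst (F t p)" "of_real t * b"] by (intro mult_mono) auto
      finally have f: "cmod (fst p) \<le> exp (cmod w) * (norm (F t p) + cmod b)" .
      have "norm p \<le> cmod (fst p) + \<bar>snd p\<bar>"
        using norm_Pair_le[of "fst p" "snd p"] by simp
      also have "\<dots> \<le> exp (cmod w) * (norm (F t p) + cmod b) + norm (F t p)"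
        using f n2 by (simp add: F_def)
      finally have "exp (norm w) * (R + norm b) + R \<le> exp (cmod w) * (norm (F t p) + cmod b) + norm (F t p)"
        using p by simp
      then have "(exp (norm w) + 1) * R \<le> (exp (norm w) + 1) * norm (F t p)"
        by (simp add: algebra_simps)
      then show ?thesis
        by (smt (verit) exp_gt_zero mult_le_cancel_left_pos)
    qed
    then show ?thesis by blast
  qed
  moreover have "F 1 = (\<lambda>(z, h). (a * z + b, h))" by (auto simp: F_def w)
  ultimately show ?thesis
    by (intro ambient_isotopic_of_proper_family[of F]) (auto simp: F_def)
qed

lemma ambient_isotopic_affine_inverse:
  assumes a: "a \<noteq> 0"
  shows "ambient_isotopic (stereo_inv ` (\<lambda>(z, h). (a * z + b, h)) ` X) (stereo_inv ` X)"
proof -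
  have "(\<lambda>(z, h). (inverse a * z + - (inverse a * b), h)) ` (\<lambda>(z, h). (a * z + b, h)) ` X = X"
    using a by (simp add: image_image case_prod_unfold distrib_left mult.assoc[symmetric])
  then show ?thesis
    using ambient_isotopic_affine[of "inverse a" "(\<lambda>(z, h). (a * z + b, h)) ` X" "- (inverse a * b)"] a by simp
qed

section \<open>Homeomorphisms supported in a region\<close>

text \<open>Bounded displacement is what the Alexander trick needs. The region \<open>U\<close> records where the map may
  differ from the identity, so that moves in disjoint regions do not disturb each other.\<close>

definition supported_move ::
    "(complex \<times> real) set \<Rightarrow> (complex \<times> real) set \<Rightarrow> (complex \<times> real) set \<Rightarrow> bool" where
  "supported_move U X Y \<longleftrightarrow>
     (\<exists>f g B. continuous_on UNIV f \<and> continuous_on UNIV g \<and>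
        (\<forall>x. g (f x) = x) \<and> (\<forall>x. f (g x) = x) \<and>
        (\<forall>x. dist (f x) x \<le> B) \<and> (\<forall>x. x \<notin> U \<longrightarrow> f x = x) \<and> f ` X = Y)"

lemma supported_moveI:
  assumes "continuous_on UNIV f" "continuous_on UNIV g" "\<And>x. g (f x) = x" "\<And>x. f (g x) = x"
    "\<And>x. dist (f x) x \<le> B" "\<And>x. x \<notin> U \<Longrightarrow> f x = x" "f ` X = Y"
  shows "supported_move U X Y"
  unfolding supported_move_def using assms by blast

lemma supported_moveE:
  assumes "supported_move U X Y"
  obtains f g B where "continuous_on UNIV f" "continuous_on UNIV g" "\<And>x. g (f x) = x"
    "\<And>x. f (g x) = x" "\<And>x. dist (f x) x \<le> B" "\<And>x. x \<notin> U \<Longrightarrow> f x = x" "f ` X = Y"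
  using assms unfolding supported_move_def by blast

lemma ambient_isotopic_of_supported_move:
  assumes "supported_move U X Y"
  shows "ambient_isotopic (stereo_inv ` X) (stereo_inv ` Y)"
  using assms by (rule supported_moveE) (rule ambient_isotopic_of_bounded_displacement)

lemma supported_move_refl: "supported_move U X X"
  by (rule supported_moveI[of id id 0]) (auto simp: continuous_on_id)

lemma supported_move_mono: "supported_move U X Y \<Longrightarrow> U \<subseteq> V \<Longrightarrow> supported_move V X Y"
  unfolding supported_move_def by (metis subsetD)

lemma supported_move_trans:
  assumes "supported_move U X Y" "supported_move U Y Z"
  shows "supported_move U X Z"
proof -
  obtain f g B where f: "continuous_on UNIV f" "continuous_on UNIV g" "\<And>x. g (f x) = x"
    "\<And>x. f (g x) = x" "\<And>x. dist (f x) x \<le> B" "\<And>x. x \<notin> U \<Longrightarrow> f x = x" "f ` X = Y"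
    using assms(1) by (rule supported_moveE) blast
  obtain f' g' B' where f': "continuous_on UNIV f'" "continuous_on UNIV g'" "\<And>x. g' (f' x) = x"
    "\<And>x. f' (g' x) = x" "\<And>x. dist (f' x) x \<le> B'" "\<And>x. x \<notin> U \<Longrightarrow> f' x = x" "f' ` Y = Z"
    using assms(2) by (rule supported_moveE) blast
  show ?thesis
  proof (rule supported_moveI)
    show "continuous_on UNIV (f' \<circ> f)" "continuous_on UNIV (g \<circ> g')"
      using f f' continuous_on_compose continuous_on_subset by blast+
    show "dist ((f' \<circ> f) x) x \<le> B' + B" for x
      using dist_triangle[of "f' (f x)" x "f x"] f(5)[of x] f'(5)[of "f x"] by simp
  qed (use f f' in \<open>auto simp: image_comp[symmetric]\<close>)
qed

lemma supported_move_sym: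
  assumes "supported_move U X Y"
  shows "supported_move U Y X"
proof -
  obtain f g B where f: "continuous_on UNIV f" "continuous_on UNIV g" "\<And>x. g (f x) = x"
    "\<And>x. f (g x) = x" "\<And>x. dist (f x) x \<le> B" "\<And>x. x \<notin> U \<Longrightarrow> f x = x" "f ` X = Y"
    using assms by (rule supported_moveE) blast
  show ?thesis
  proof (rule supported_moveI[OF f(2,1,4,3)])
    show "dist (g x) x \<le> B" for x using f(5)[of "g x"] f(4)[of x] by (simp add: dist_commute)
    show "g x = x" if "x \<notin> U" for x using f(6)[OF that] f(3)[of x] by simp
    show "g ` Y = X" by (simp add: image_image f(3) flip: f(7))
  qed
qed

text \<open>A point outside \<open>U\<close> is fixed, hence already lies in \<open>Y\<close>.\<close>

lemma supported_move_subset: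
  assumes "supported_move U X Y" "Y \<subseteq> Z" "U \<subseteq> Z"
  shows "X \<subseteq> Z"
proof
  fix x assume x: "x \<in> X"
  from assms(1) obtain f where "\<And>x. x \<notin> U \<Longrightarrow> f x = x" "f ` X = Y"
    by (elim supported_moveE) blast
  then show "x \<in> Z" using x assms(2,3) by (metis image_eqI subset_iff)
qed

text \<open>Performing the first move and then the second is possible because the first leaves \<open>X'\<close> alone and
  the second leaves \<open>Y\<close> alone.\<close>

lemma supported_move_Un:
  assumes "supported_move U X Y" "supported_move U' X' Y'"
    and "X' \<inter> U = {}" "Y \<inter> U' = {}"
  shows "supported_move (U \<union> U') (X \<union> X') (Y \<union> Y')"
proof -
  have "supported_move U (X \<union> X') (Y \<union> X')"
  proof -
    obtain f g B where f: "continuous_on UNIV f" "continuous_on UNIV g" "\<And>x. g (f x) = x"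
      "\<And>x. f (g x) = x" "\<And>x. dist (f x) x \<le> B" "\<And>x. x \<notin> U \<Longrightarrow> f x = x" "f ` X = Y"
      using assms(1) by (rule supported_moveE) blast
    have "f ` X' = id ` X'" using f(6) assms(3) by (intro image_cong) auto
    then show ?thesis using f(7) by (intro supported_moveI[OF f(1-6)]) (auto simp: image_Un)
  qed
  moreover have "supported_move U' (Y \<union> X') (Y \<union> Y')"
  proof -
    obtain f g B where f: "continuous_on UNIV f" "continuous_on UNIV g" "\<And>x. g (f x) = x"
      "\<And>x. f (g x) = x" "\<And>x. dist (f x) x \<le> B" "\<And>x. x \<notin> U' \<Longrightarrow> f x = x" "f ` X' = Y'"
      using assms(2) by (rule supported_moveE) blast
    have "f ` Y = id ` Y" using f(6) assms(4) by (intro image_cong) auto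
    then show ?thesis using f(7) by (intro supported_moveI[OF f(1-6)]) (auto simp: image_Un)
  qed
  ultimately show ?thesis
    by (meson supported_move_mono supported_move_trans Un_upper1 Un_upper2)
qed

text \<open>Each support avoids the pieces of all other moves, so the moves can be performed one after another.\<close>

lemma supported_move_UN:
  assumes "finite I"
    and move: "\<And>i. i \<in> I \<Longrightarrow> supported_move (U i) (X i) (Y i)"
    and disj: "\<And>i j. i \<in> I \<Longrightarrow> j \<in> I \<Longrightarrow> i \<noteq> j \<Longrightarrow> X j \<inter> U i = {} \<and> Y j \<inter> U i = {}"
    and rest: "\<And>i. i \<in> I \<Longrightarrow> Z \<inter> U i = {}"
  shows "supported_move (\<Union>i\<in>I. U i) (Z \<union> (\<Union>i\<in>I. X i)) (Z \<union> (\<Union>i\<in>I. Y i))"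
  using assms
proof (induction I rule: finite_induct)
  case empty
  then show ?case by (simp add: supported_move_refl)
next
  case (insert i I)
  have "supported_move (U i \<union> (\<Union>i\<in>I. U i))
      (X i \<union> (Z \<union> (\<Union>i\<in>I. X i))) (Y i \<union> (Z \<union> (\<Union>i\<in>I. Y i)))"
  proof (rule supported_move_Un)
    show "supported_move (U i) (X i) (Y i)" using insert.prems(1) by blast
    show "supported_move (\<Union>i\<in>I. U i) (Z \<union> (\<Union>i\<in>I. X i)) (Z \<union> (\<Union>i\<in>I. Y i))"
      by (rule insert.IH) (use insert.prems in auto)
    show "(Z \<union> (\<Union>i\<in>I. X i)) \<inter> U i = {}"
      using insert.prems(2)[of i] insert.prems(3)[of i] insert.hyps by blast
    show "Y i \<inter> (\<Union>i\<in>I. U i) = {}"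
      using insert.prems(2)[of _ i] insert.hyps by blast
  qed
  moreover have "X i \<union> (Z \<union> (\<Union>i\<in>I. X i)) = Z \<union> (\<Union>i\<in>insert i I. X i)"
    "Y i \<union> (Z \<union> (\<Union>i\<in>I. Y i)) = Z \<union> (\<Union>i\<in>insert i I. Y i)"
    "U i \<union> (\<Union>i\<in>I. U i) = (\<Union>i\<in>insert i I. U i)"
    by auto
  ultimately show ?case by (simp only:)
qed

lemma supported_move_isometry:
  assumes "supported_move U X Y"
    and contp: "continuous_on UNIV p" and contq: "continuous_on UNIV q"
    and qp: "\<And>x. q (p x) = x" and pq: "\<And>x. p (q x) = x"
    and iso: "\<And>x y. dist (p x) (p y) = dist x y"
  shows "supported_move (p ` U) (p ` X) (p ` Y)"
proof -
  obtain f g B where f: "continuous_on UNIV f" "continuous_on UNIV g" "\<And>x. g (f x) = x"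
    "\<And>x. f (g x) = x" "\<And>x. dist (f x) x \<le> B" "\<And>x. x \<notin> U \<Longrightarrow> f x = x" "f ` X = Y"
    using assms(1) by (rule supported_moveE) blast
  show ?thesis
  proof (rule supported_moveI)
    show "continuous_on UNIV (\<lambda>x. p (f (q x)))"
      by (rule continuous_on_compose2[OF contp])
        (auto intro!: continuous_on_compose2[OF f(1) contq])
    show "continuous_on UNIV (\<lambda>x. p (g (q x)))"
      by (rule continuous_on_compose2[OF contp])
        (auto intro!: continuous_on_compose2[OF f(2) contq])
    show "dist (p (f (q x))) x \<le> B" for x
      using iso[of "f (q x)" "q x"] f(5)[of "q x"] pq[of x] by simp
    show "p (f (q x)) = x" if "x \<notin> p ` U" for x
    proof -
      have "q x \<notin> U" using that pq[of x] by (metis image_eqI)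
      then show ?thesis using f(6) pq by simp
    qed
    show "(\<lambda>x. p (f (q x))) ` p ` X = p ` Y"
      using f(7) qp by (auto simp: image_image)
  qed (use f qp pq in auto)
qed

definition place :: "complex \<Rightarrow> complex \<times> real \<Rightarrow> complex \<times> real" where
  "place c = (\<lambda>(z, h). (c + z, h))"

definition turn :: "complex \<Rightarrow> complex \<times> real \<Rightarrow> complex \<times> real" where
  "turn a = (\<lambda>(z, h). (a * z, h))"

lemma supported_move_place:
  assumes "supported_move U X Y"
  shows "supported_move (place c ` U) (place c ` X) (place c ` Y)"
proof (rule supported_move_isometry[OF assms, of _ "place (- c)"])
  have *: "continuous_on UNIV (place c)" for c
    unfolding place_def case_prod_unfold by (intro continuous_intros)
  show "continuous_on UNIV (place c)" "continuous_on UNIV (place (- c))"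
    by (rule *)+
  show "dist (place c x) (place c y) = dist x y" for x y
    by (cases x; cases y) (simp add: place_def dist_Pair_Pair)
qed (auto simp: place_def case_prod_unfold)

lemma supported_move_turn:
  assumes "supported_move U X Y" "cmod a = 1"
  shows "supported_move (turn a ` U) (turn a ` X) (turn a ` Y)"
proof (rule supported_move_isometry[OF assms(1), of _ "turn (inverse a)"])
  have *: "continuous_on UNIV (turn a)" for a
    unfolding turn_def case_prod_unfold by (intro continuous_intros)
  show "continuous_on UNIV (turn a)" "continuous_on UNIV (turn (inverse a))"
    by (rule *)+
  have "a \<noteq> 0" using assms(2) by auto
  then show "turn (inverse a) (turn a x) = x" "turn a (turn (inverse a) x) = x" for x
    by (simp_all add: turn_def case_prod_unfold mult.assoc[symmetric])
  show "dist (turn a x) (turn a y) = dist x y" for x y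
  proof -
    have "dist (a * z) (a * z') = dist z z'" for z z'
      using assms(2) by (simp add: dist_norm right_diff_distrib[symmetric] norm_mult)
    then show ?thesis by (cases x; cases y) (simp add: turn_def dist_Pair_Pair)
  qed
qed

section \<open>Shears that carry one graph to another\<close>

text \<open>An increasing piecewise linear map of the line that takes \<open>r\<close> to \<open>s\<close>: it has slope 3 on the way
  up to \<open>r\<close>, slope 1/3 afterwards, and returns to the identity at distance \<open>(s - r) / 2\<close> from the
  interval between \<open>r\<close> and \<open>s\<close>. It degenerates to the identity for \<open>r = s\<close> and depends
  continuously on \<open>r\<close> and \<open>s\<close>, so no cutoff function is needed where two graphs meet.\<close>

definition stretch :: "real \<Rightarrow> real \<Rightarrow> real \<Rightarrow> real" where
  "stretch r s u = max u (min (3 * (u - r) + s) ((u - r) / 3 + s))"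

definition unstretch :: "real \<Rightarrow> real \<Rightarrow> real \<Rightarrow> real" where
  "unstretch r s u = min u (max ((u - s) / 3 + r) (3 * (u - s) + r))"

lemma unstretch_stretch: "r \<le> s \<Longrightarrow> unstretch r s (stretch r s u) = u"
  unfolding stretch_def unstretch_def max_def min_def by (auto simp: field_simps)

lemma stretch_unstretch: "r \<le> s \<Longrightarrow> stretch r s (unstretch r s u) = u"
  unfolding stretch_def unstretch_def max_def min_def by (auto simp: field_simps)

lemma stretch_at: "r \<le> s \<Longrightarrow> stretch r s r = s"
  unfolding stretch_def by simp

lemma stretch_displacement: "r \<le> s \<Longrightarrow> \<bar>stretch r s u - u\<bar> \<le> s - r"
  unfolding stretch_def max_def min_def by (auto simp: field_simps)

lemma stretch_support:
  assumes "r \<le> s" "stretch r s u \<noteq> u"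
  shows "r < s" "r - (s - r) / 2 < u" "u < s + (s - r) / 2"
  using assms unfolding stretch_def max_def min_def by (auto simp: field_simps split: if_splits)

text \<open>On each line in the direction \<open>e\<close>, with coordinate \<open>l\<close>, the graphs of \<open>r\<close> and \<open>s\<close> are single
  points, and \<open>stretch\<close> moves one to the other.\<close>

lemma supported_move_shear:
  fixes e :: "complex \<times> real" and l r s :: "complex \<times> real \<Rightarrow> real"
  assumes cont: "continuous_on UNIV l" "continuous_on UNIV r" "continuous_on UNIV s"
    and along: "\<And>x t. l (x + t *\<^sub>R e) = l x + t" "\<And>x t. r (x + t *\<^sub>R e) = r x"
      "\<And>x t. s (x + t *\<^sub>R e) = s x" "\<And>x t. x + t *\<^sub>R e \<in> C \<longleftrightarrow> x \<in> C"
    and le: "\<And>x. r x \<le> s x" and bound: "\<And>x. s x - r x \<le> B"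
    and support: "\<And>x. r x < s x \<Longrightarrow> r x - (s x - r x) / 2 < l x \<Longrightarrow>
      l x < s x + (s x - r x) / 2 \<Longrightarrow> x \<in> U"
  shows "supported_move U {x \<in> C. l x = r x} {x \<in> C. l x = s x}"
proof -
  define f where "f = (\<lambda>x. x + (stretch (r x) (s x) (l x) - l x) *\<^sub>R e)"
  define g where "g = (\<lambda>x. x + (unstretch (r x) (s x) (l x) - l x) *\<^sub>R e)"
  have gf: "g (f x) = x" for x
    unfolding g_def
    by (simp add: f_def along unstretch_stretch[OF le] flip: scaleR_add_left)
  have fg: "f (g x) = x" for x
    unfolding f_def
    by (simp add: g_def along stretch_unstretch[OF le] flip: scaleR_add_left)
  show ?thesis
  proof (rule supported_moveI[of f g])
    show "continuous_on UNIV f" "continuous_on UNIV g"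
      unfolding f_def g_def stretch_def unstretch_def
      by (auto intro!: continuous_intros cont continuous_on_max continuous_on_min)
    show "dist (f x) x \<le> B * norm e" for x
    proof -
      have "dist (f x) x = \<bar>stretch (r x) (s x) (l x) - l x\<bar> * norm e"
        by (simp add: f_def dist_norm)
      also have "\<dots> \<le> B * norm e"
        using stretch_displacement[OF le, of x "l x"] bound[of x] by (intro mult_right_mono) auto
      finally show ?thesis .
    qed
    show "f x = x" if "x \<notin> U" for x
    proof -
      have "stretch (r x) (s x) (l x) = l x"
        using stretch_support[OF le] support that by blast
      then show ?thesis by (simp add: f_def)
    qed
    show "f ` {x \<in> C. l x = r x} = {x \<in> C. l x = s x}"
    proof (intro subset_antisym subsetI)
      fix y assume "y \<in> f ` {x \<in> C. l x = r x}"
      then show "y \<in> {x \<in> C. l x = s x}"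
        by (auto simp: f_def along stretch_at[OF le])
    next
      fix y assume y: "y \<in> {x \<in> C. l x = s x}"
      have "unstretch (r y) (s y) (s y) = r y"
        using unstretch_stretch[OF le, of y "r y"] stretch_at[OF le, of y] by simp
      then have "g y \<in> {x \<in> C. l x = r x}"
        using y by (simp add: g_def along)
      then show "y \<in> f ` {x \<in> C. l x = r x}"
        by (rule image_eqI[where x = "g y" and f = f, OF fg[of y, symmetric]])
    qed
  qed (use fg gf in auto)
qed

section \<open>Moving the curves of a single tile\<close>

text \<open>In the coordinates \<open>u = Re z + Im z\<close> and \<open>v = Re z - Im z\<close>, the equation \<open>u = corner_graph r v\<close>
  describes the curve that comes in along the positive real axis, rounds the corner at the origin on
  the circle of radius \<open>r\<close> about \<open>(r, r)\<close>, and leaves along the positive imaginary axis. For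
  \<open>r = 0\<close> it is the angle formed by the two half-axes. The inner maximum only keeps the radicand
  nonnegative on the straight parts.\<close>

definition corner_graph :: "real \<Rightarrow> real \<Rightarrow> real" where
  "corner_graph r v = max \<bar>v\<bar> (2 * r - sqrt (max (r\<^sup>2) (2 * r\<^sup>2 - v\<^sup>2)))"

lemma corner_graph_ge_abs: "\<bar>v\<bar> \<le> corner_graph r v"
  by (simp add: corner_graph_def)

lemma corner_graph_0: "corner_graph 0 v = \<bar>v\<bar>"
  by (simp add: corner_graph_def max_def)

lemma corner_graph_outside:
  assumes "0 \<le> r" "r \<le> \<bar>v\<bar>"
  shows "corner_graph r v = \<bar>v\<bar>"
proof -
  have "r \<le> sqrt (max (r\<^sup>2) (2 * r\<^sup>2 - v\<^sup>2))"
    using assms(1) by (intro real_le_rsqrt) simp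
  then show ?thesis using assms by (simp add: corner_graph_def max_def)
qed

lemma corner_graph_inside:
  assumes "0 \<le> r" "\<bar>v\<bar> \<le> r"
  shows "corner_graph r v = 2 * r - sqrt (2 * r\<^sup>2 - v\<^sup>2)"
proof -
  have "v\<^sup>2 \<le> r\<^sup>2" using assms by (simp add: abs_le_square_iff[symmetric])
  then have m: "max (r\<^sup>2) (2 * r\<^sup>2 - v\<^sup>2) = 2 * r\<^sup>2 - v\<^sup>2" by simp
  have "0 \<le> (r - \<bar>v\<bar>)\<^sup>2" by simp
  then have "2 * r\<^sup>2 - v\<^sup>2 \<le> (2 * r - \<bar>v\<bar>)\<^sup>2"
    by (simp add: power2_eq_square algebra_simps)
  then have "sqrt (2 * r\<^sup>2 - v\<^sup>2) \<le> 2 * r - \<bar>v\<bar>"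
    using assms by (intro real_le_lsqrt) auto
  then show ?thesis unfolding corner_graph_def m by simp
qed

text \<open>The arc lies below its chords, and \<open>2 - sqrt 2 < 3/5\<close>. With the additional half of the
  displacement that \<open>stretch\<close> uses, the factor becomes \<open>9/10 < 1\<close>, which keeps the shears inside
  the tile.\<close>

lemma corner_graph_upper:
  assumes "0 \<le> r"
  shows "corner_graph r v \<le> \<bar>v\<bar> + 3/5 * max 0 (r - \<bar>v\<bar>)"
proof (cases "\<bar>v\<bar> \<le> r")
  case True
  \<comment> \<open>The square of the claimed bound differs from the radicand by a multiple of this product.\<close>
  have "0 \<le> (r - \<bar>v\<bar>) * (r + 29 * \<bar>v\<bar>)" using True assms by simp
  then have "(7/5 * r - 2/5 * \<bar>v\<bar>)\<^sup>2 \<le> 2 * r\<^sup>2 - v\<^sup>2"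
    by (simp add: power2_eq_square algebra_simps)
  then have "7/5 * r - 2/5 * \<bar>v\<bar> \<le> sqrt (2 * r\<^sup>2 - v\<^sup>2)"
    by (rule real_le_rsqrt)
  moreover have "max 0 (r - \<bar>v\<bar>) = r - \<bar>v\<bar>" using True by simp
  ultimately show ?thesis
    unfolding corner_graph_inside[OF assms True] by (simp add: field_simps)
qed (simp add: corner_graph_outside assms)

lemma corner_graph_half_lower: "1/4 \<le> corner_graph (1/2) v"
proof -
  have "max ((1/2)\<^sup>2) (2 * (1/2)\<^sup>2 - v\<^sup>2) \<le> (3/4)\<^sup>2"
  proof -
    have "(1/2 :: real)\<^sup>2 = 1/4" "(3/4 :: real)\<^sup>2 = 9/16" by (simp_all add: power_divide)
    then show ?thesis using zero_le_power2[of v] by (intro max.boundedI) linarith+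
  qed
  then have "sqrt (max ((1/2)\<^sup>2) (2 * (1/2)\<^sup>2 - v\<^sup>2)) \<le> 3/4"
    by (intro real_le_lsqrt) simp_all
  then show ?thesis unfolding corner_graph_def by (intro max.coboundedI2) simp
qed

lemma corner_graph_half_le_one: "corner_graph (1/2) v \<le> corner_graph 1 v"
proof (cases "\<bar>v\<bar> \<le> 1/2")
  case True
  have "v\<^sup>2 \<le> (1/2)\<^sup>2" using True by (metis abs_le_square_iff abs_of_pos half_gt_zero zero_less_one)
  then have v: "v\<^sup>2 \<le> 1/4" by (simp add: power2_eq_square)
  have q: "1/2 \<le> sqrt (1/2 - v\<^sup>2)"
    using v by (intro real_le_rsqrt) (simp add: power2_eq_square)
  have "2 - v\<^sup>2 \<le> (1 + sqrt (1/2 - v\<^sup>2))\<^sup>2"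
    using q v by (simp add: power2_sum)
  then have "sqrt (2 - v\<^sup>2) \<le> 1 + sqrt (1/2 - v\<^sup>2)"
    using q by (intro real_le_lsqrt) auto
  then show ?thesis
    using True corner_graph_inside[of "1/2" v] corner_graph_inside[of 1 v]
    by (simp add: power2_eq_square)
next
  case False
  then show ?thesis using corner_graph_outside[of "1/2" v] corner_graph_ge_abs[of v 1] by simp
qed

lemma continuous_corner_graph: "continuous_on A (corner_graph r)"
  unfolding corner_graph_def by (intro continuous_intros continuous_on_max)

text \<open>The conditions on the left say that \<open>(x, y)\<close> lies on the circle of radius \<open>r\<close> about \<open>(r, r)\<close>,
  on the quarter that faces the origin.\<close>

lemma circle_eq_corner_graph:
  assumes r: "r > 0"
  shows "\<bar>x\<bar> \<le> r \<and> \<bar>y\<bar> \<le> r \<and> (x - r)\<^sup>2 + (y - r)\<^sup>2 = r\<^sup>2 \<longleftrightarrow>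
    \<bar>x - y\<bar> \<le> r \<and> x + y = corner_graph r (x - y)" (is "?L \<longleftrightarrow> ?R")
proof -
  \<comment> \<open>In the coordinates \<open>x + y\<close> and \<open>x - y\<close> the circle is scaled by \<open>sqrt 2\<close>.\<close>
  have id: "(2 * r - (x + y))\<^sup>2 + (x - y)\<^sup>2 = 2 * ((x - r)\<^sup>2 + (y - r)\<^sup>2)"
    by (simp add: power2_eq_square algebra_simps)
  show ?thesis
  proof
    assume L: ?L
    have "(r - x)\<^sup>2 \<le> r\<^sup>2" "(r - y)\<^sup>2 \<le> r\<^sup>2"
      using L by (smt (verit) power2_commute zero_le_power2)+
    then have "r - x \<le> r" "r - y \<le> r" using r by (meson less_imp_le power2_le_imp_le)+
    then have v: "\<bar>x - y\<bar> \<le> r" using L by auto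
    have "(2 * r - (x + y))\<^sup>2 = 2 * r\<^sup>2 - (x - y)\<^sup>2" using id L by simp
    moreover have "2 * r - (x + y) \<ge> 0" using L by auto
    ultimately have "2 * r - (x + y) = sqrt (2 * r\<^sup>2 - (x - y)\<^sup>2)"
      by (metis real_sqrt_abs abs_of_nonneg)
    then show ?R using v corner_graph_inside[OF less_imp_le[OF r] v] by simp
  next
    assume R: ?R
    have "(x - y)\<^sup>2 \<le> r\<^sup>2" using R r by (simp add: abs_le_square_iff[symmetric])
    then have "0 \<le> 2 * r\<^sup>2 - (x - y)\<^sup>2" by (smt (verit) zero_le_power2)
    moreover have "2 * r - (x + y) = sqrt (2 * r\<^sup>2 - (x - y)\<^sup>2)"
      using R r corner_graph_inside[of r "x - y"] by simp
    ultimately have "(2 * r - (x + y))\<^sup>2 = 2 * r\<^sup>2 - (x - y)\<^sup>2" by simp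
    then have "(x - r)\<^sup>2 + (y - r)\<^sup>2 = r\<^sup>2" using id by simp
    moreover have "\<bar>x - y\<bar> \<le> x + y" using R corner_graph_ge_abs[of "x - y" r] by simp
    moreover have "x + y \<le> \<bar>x - y\<bar> + 3/5 * (r - \<bar>x - y\<bar>)"
      using R r corner_graph_upper[of r "x - y"] by simp
    then have "x + y \<le> r" using R by argo
    ultimately show ?L by auto
  qed
qed

text \<open>The part of this curve between the points at distance \<open>w\<close> from the origin on the two half-axes.\<close>

definition corner_curve :: "real \<Rightarrow> real \<Rightarrow> (complex \<times> real) set" where
  "corner_curve w r = {(z, h). h = 0 \<and> \<bar>Re z - Im z\<bar> \<le> w \<and> Re z + Im z = corner_graph r (Re z - Im z)}"

text \<open>The shear moves along the diagonal, that is in the coordinate \<open>u\<close>. The assumption \<open>support\<close> asks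
  that the strip between the two graphs, widened by the margin of \<open>stretch\<close>, lie over \<open>U\<close>; at the top, the
  estimate of \<open>corner_graph_upper\<close> takes the place of the exact margin.\<close>

lemma supported_move_corner_curve:
  assumes le: "\<And>v. corner_graph r v \<le> corner_graph s v" and s: "0 \<le> s"
    and support: "\<And>z h. \<bar>Re z - Im z\<bar> < s \<Longrightarrow>
      corner_graph r (Re z - Im z) - (corner_graph s (Re z - Im z) - corner_graph r (Re z - Im z)) / 2 < Re z + Im z \<Longrightarrow>
      Re z + Im z < \<bar>Re z - Im z\<bar> + 9/10 * (s - \<bar>Re z - Im z\<bar>) \<Longrightarrow> (z, h) \<in> U"
  shows "supported_move U (corner_curve w r) (corner_curve w s)"
proof -
  define l :: "complex \<times> real \<Rightarrow> real" where "l = (\<lambda>x. Re (fst x) + Im (fst x))"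
  define v :: "complex \<times> real \<Rightarrow> real" where "v = (\<lambda>x. Re (fst x) - Im (fst x))"
  \<comment> \<open>The vector along which \<open>l\<close> grows with speed 1 and \<open>v\<close> stays constant.\<close>
  define e :: "complex \<times> real" where "e = (Complex (1/2) (1/2), 0)"
  define C :: "(complex \<times> real) set" where "C = {x. snd x = 0 \<and> \<bar>v x\<bar> \<le> w}"
  have v: "v (x + t *\<^sub>R e) = v x" for x t by (simp add: v_def e_def)
  have contv: "continuous_on UNIV v" unfolding v_def by (intro continuous_intros)
  have up: "corner_graph s u \<le> \<bar>u\<bar> + 3/5 * max 0 (s - \<bar>u\<bar>)" for u
    by (rule corner_graph_upper[OF s])
  have "supported_move U {x \<in> C. l x = corner_graph r (v x)} {x \<in> C. l x = corner_graph s (v x)}"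
  proof (rule supported_move_shear[where e = e and B = s])
    show "continuous_on UNIV l" unfolding l_def by (intro continuous_intros)
    show "continuous_on UNIV (\<lambda>x. corner_graph r (v x))" "continuous_on UNIV (\<lambda>x. corner_graph s (v x))"
      by (rule continuous_on_compose2[OF continuous_corner_graph[of UNIV] contv]; simp)+
    show "l (x + t *\<^sub>R e) = l x + t" for x t by (simp add: l_def e_def)
    show "x + t *\<^sub>R e \<in> C \<longleftrightarrow> x \<in> C" for x t by (simp add: C_def v) (simp add: e_def)
    show "corner_graph s (v x) - corner_graph r (v x) \<le> s" for x
    proof -
      have "\<bar>v x\<bar> + 3/5 * max 0 (s - \<bar>v x\<bar>) \<le> \<bar>v x\<bar> + s" using s by (auto simp: max_def)
      then show ?thesis using up[of "v x"] corner_graph_ge_abs[of "v x" r] by linarith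
    qed
    fix x
    assume *: "corner_graph r (v x) < corner_graph s (v x)"
      "corner_graph r (v x) - (corner_graph s (v x) - corner_graph r (v x)) / 2 < l x"
      "l x < corner_graph s (v x) + (corner_graph s (v x) - corner_graph r (v x)) / 2"
    have a: "\<bar>v x\<bar> < s"
      using *(1) corner_graph_outside[OF s, of "v x"] corner_graph_ge_abs[of "v x" r] by linarith
    have "l x < \<bar>v x\<bar> + 9/10 * (s - \<bar>v x\<bar>)"
      using a *(3) up[of "v x"] corner_graph_ge_abs[of "v x" r] unfolding max_def by argo
    then show "x \<in> U"
      using support[of "fst x" "snd x"] a *(2) by (simp add: v_def l_def)
  qed (use le v in auto)
  moreover have "{x \<in> C. l x = corner_graph q (v x)} = corner_curve w q" for q
    by (auto simp: C_def corner_curve_def l_def v_def)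
  ultimately show ?thesis by simp
qed

definition open_diamond :: "(complex \<times> real) set" where
  "open_diamond = {(z, h). \<bar>Re z\<bar> + \<bar>Im z\<bar> < 1}"

definition open_square :: "(complex \<times> real) set" where
  "open_square = {(z, h). \<bar>Re z\<bar> < 1/2 \<and> \<bar>Im z\<bar> < 1/2}"

text \<open>The support stays on the positive side of the antidiagonal, so that a second arc in the opposite
  corner of the same tile is not touched.\<close>

lemma supported_move_corner_curve_diamond:
  "supported_move (open_diamond \<inter> {(z, h). Re z + Im z > 0}) (corner_curve 1 (1/2)) (corner_curve 1 1)"
proof (rule supported_move_corner_curve)
  fix z h
  let ?v = "Re z - Im z"
  assume v: "\<bar>?v\<bar> < 1" and
    *: "corner_graph (1/2) ?v - (corner_graph 1 ?v - corner_graph (1/2) ?v) / 2 < Re z + Im z"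
    "Re z + Im z < \<bar>?v\<bar> + 9/10 * (1 - \<bar>?v\<bar>)"
  have "corner_graph 1 ?v \<le> \<bar>?v\<bar> + 3/5 * (1 - \<bar>?v\<bar>)"
    using corner_graph_upper[of 1 ?v] v by (simp add: max_def)
  then have "0 < Re z + Im z"
    using *(1) v corner_graph_half_lower[of ?v] corner_graph_ge_abs[of ?v "1/2"] by argo
  moreover have "Re z + Im z < 1" using *(2) v by argo
  ultimately show "(z, h) \<in> open_diamond \<inter> {(z, h). Re z + Im z > 0}"
    using v by (auto simp: open_diamond_def)
qed (simp_all add: corner_graph_half_le_one)

lemma supported_move_corner_curve_square:
  "supported_move open_square (corner_curve (1/2) 0) (corner_curve (1/2) (1/2))"
proof (rule supported_move_corner_curve)
  fix z h
  let ?v = "Re z - Im z"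
  assume v: "\<bar>?v\<bar> < 1/2" and
    *: "corner_graph 0 ?v - (corner_graph (1/2) ?v - corner_graph 0 ?v) / 2 < Re z + Im z"
    "Re z + Im z < \<bar>?v\<bar> + 9/10 * (1/2 - \<bar>?v\<bar>)"
  have "corner_graph (1/2) ?v \<le> \<bar>?v\<bar> + 3/5 * (1/2 - \<bar>?v\<bar>)"
    using corner_graph_upper[of "1/2" ?v] v by (simp add: max_def)
  then have "\<bar>?v\<bar> - 3/10 * (1/2 - \<bar>?v\<bar>) < Re z + Im z"
    using *(1) v unfolding corner_graph_0 by argo
  then show "(z, h) \<in> open_square"
    using v *(2) unfolding open_square_def abs_if by simp argo
qed (simp_all add: corner_graph_0 corner_graph_ge_abs)

text \<open>The segment from the midpoint \<open>d\<close> of a side of the unit square to the centre \<open>2 * d\<close> of the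
  adjacent square.\<close>

definition stub :: "complex \<Rightarrow> (complex \<times> real) set" where
  "stub d = closed_segment d (2 * d) \<times> {0}"

definition spoke :: "complex \<Rightarrow> (complex \<times> real) set" where
  "spoke d = closed_segment 0 d \<times> {0}"

text \<open>Only the plane is scaled: the over-strand of a crossing keeps its height 1/2 above the centre.\<close>

definition double :: "complex \<times> real \<Rightarrow> complex \<times> real" where
  "double = (\<lambda>(z, h). (2 * z, h))"

lemma cmod_diff_corner:
  "cmod (z - (1/2 + \<i>/2)) = 1/2 \<longleftrightarrow> (Re z - 1/2)\<^sup>2 + (Im z - 1/2)\<^sup>2 = (1/2)\<^sup>2"
proof -
  have "cmod (z - (1/2 + \<i>/2)) = 1/2 \<longleftrightarrow> (cmod (z - (1/2 + \<i>/2)))\<^sup>2 = (1/2)\<^sup>2"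
    by (subst power2_eq_iff_nonneg) auto
  then show ?thesis by (simp add: cmod_power2)
qed

lemma mem_corner_arc:
  "(z, h) \<in> corner_arc (1/2) (\<i>/2) \<longleftrightarrow>
     h = 0 \<and> \<bar>Re z\<bar> \<le> 1/2 \<and> \<bar>Im z\<bar> \<le> 1/2 \<and> (Re z - 1/2)\<^sup>2 + (Im z - 1/2)\<^sup>2 = (1/2)\<^sup>2"
  unfolding corner_arc_def unit_square_def cmod_diff_corner by blast

lemma mem_corner_curve:
  "(z, h) \<in> corner_curve w r \<longleftrightarrow>
     h = 0 \<and> \<bar>Re z - Im z\<bar> \<le> w \<and> Re z + Im z = corner_graph r (Re z - Im z)"
  unfolding corner_curve_def by blast

lemma corner_arc_eq_corner_curve: "corner_arc (1/2) (\<i>/2) = corner_curve (1/2) (1/2)"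
proof -
  have "(z, h) \<in> corner_arc (1/2) (\<i>/2) \<longleftrightarrow> (z, h) \<in> corner_curve (1/2) (1/2)" for z h
    unfolding mem_corner_arc mem_corner_curve using circle_eq_corner_graph[of "1/2" "Re z" "Im z"]
    by (simp only: half_gt_zero zero_less_one simp_thms)
  then show ?thesis by (intro set_eqI) (simp add: split_paired_all)
qed

lemma double_corner_arc_eq_corner_curve: "double ` corner_arc (1/2) (\<i>/2) = corner_curve 1 1"
proof -
  have *: "(2 * z, 0) \<in> corner_curve 1 1 \<longleftrightarrow> (z, 0) \<in> corner_arc (1/2) (\<i>/2)" for z
  proof -
    have "(2 * x - 1)\<^sup>2 = 4 * (x - 1/2)\<^sup>2" for x :: real
      by (simp add: power2_eq_square algebra_simps)
    then have "(2 * Re z - 1)\<^sup>2 + (2 * Im z - 1)\<^sup>2 = 1\<^sup>2 \<longleftrightarrow> (Re z - 1/2)\<^sup>2 + (Im z - 1/2)\<^sup>2 = (1/2)\<^sup>2"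
      by (simp add: power2_eq_square[of "1/2 :: real"] mult.commute)
    then show ?thesis
      unfolding mem_corner_arc mem_corner_curve
      using circle_eq_corner_graph[of 1 "2 * Re z" "2 * Im z"] by auto
  qed
  show ?thesis
  proof (intro subset_antisym subsetI)
    fix x assume "x \<in> double ` corner_arc (1/2) (\<i>/2)"
    then obtain z where "x = (2 * z, 0)" "(z, 0) \<in> corner_arc (1/2) (\<i>/2)"
      by (auto simp: double_def corner_arc_def)
    then show "x \<in> corner_curve 1 1" using * by simp
  next
    fix x assume x: "x \<in> corner_curve 1 1"
    then obtain w where w: "x = (w, 0)" by (auto simp: corner_curve_def)
    then have "(w / 2, 0) \<in> corner_arc (1/2) (\<i>/2)" "x = double (w / 2, 0)"
      using x *[of "w / 2"] by (auto simp: double_def)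
    then show "x \<in> double ` corner_arc (1/2) (\<i>/2)" by blast
  qed
qed

lemma closed_segment_real_axis:
  "r \<le> s \<Longrightarrow> closed_segment (of_real r) (of_real s :: complex) = {z. Im z = 0 \<and> r \<le> Re z \<and> Re z \<le> s}"
  by (subst closed_segment_same_Im) (auto simp: closed_segment_eq_real_ivl)

lemma closed_segment_imaginary_axis:
  "r \<le> s \<Longrightarrow> closed_segment (of_real r * \<i>) (of_real s * \<i>) = {z. Re z = 0 \<and> r \<le> Im z \<and> Im z \<le> s}"
  by (subst closed_segment_same_Re) (auto simp: closed_segment_eq_real_ivl)

lemma stub_right: "stub (1/2) = {(z, h). h = 0 \<and> Im z = 0 \<and> 1/2 \<le> Re z \<and> Re z \<le> 1}"
proof -
  have "closed_segment (1/2) (2 * (1/2)) = {z. Im z = 0 \<and> 1/2 \<le> Re z \<and> Re z \<le> 1}"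
    using closed_segment_real_axis[of "1/2" 1] by simp
  then show ?thesis unfolding stub_def by blast
qed

lemma stub_left: "stub (-1/2) = {(z, h). h = 0 \<and> Im z = 0 \<and> -1 \<le> Re z \<and> Re z \<le> -1/2}"
proof -
  have "closed_segment (-1/2) (2 * (-1/2)) = {z. Im z = 0 \<and> -1 \<le> Re z \<and> Re z \<le> -1/2}"
    using closed_segment_real_axis[of "-1" "-1/2"] closed_segment_commute[of "-1/2" "- 1 :: complex"] by simp
  then show ?thesis unfolding stub_def by blast
qed

lemma stub_top: "stub (\<i>/2) = {(z, h). h = 0 \<and> Re z = 0 \<and> 1/2 \<le> Im z \<and> Im z \<le> 1}"
proof -
  have "closed_segment (\<i>/2) (2 * (\<i>/2)) = {z. Re z = 0 \<and> 1/2 \<le> Im z \<and> Im z \<le> 1}"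
    using closed_segment_imaginary_axis[of "1/2" 1] by simp
  then show ?thesis unfolding stub_def by blast
qed

lemma spoke_right: "spoke (1/2) = {(z, h). h = 0 \<and> Im z = 0 \<and> 0 \<le> Re z \<and> Re z \<le> 1/2}"
proof -
  have "closed_segment 0 (1/2) = {z. Im z = 0 \<and> 0 \<le> Re z \<and> Re z \<le> 1/2}"
    using closed_segment_real_axis[of 0 "1/2"] by simp
  then show ?thesis unfolding spoke_def by blast
qed

lemma spoke_top: "spoke (\<i>/2) = {(z, h). h = 0 \<and> Re z = 0 \<and> 0 \<le> Im z \<and> Im z \<le> 1/2}"
proof -
  have "closed_segment 0 (\<i>/2) = {z. Re z = 0 \<and> 0 \<le> Im z \<and> Im z \<le> 1/2}"
    using closed_segment_imaginary_axis[of 0 "1/2"] by simp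
  then show ?thesis unfolding spoke_def by blast
qed

lemma spokes_eq_corner_curve: "spoke (1/2) \<union> spoke (\<i>/2) = corner_curve (1/2) 0"
  unfolding spoke_right spoke_top corner_curve_def corner_graph_0 by (auto simp: abs_if split: if_splits)

lemma arc_stubs_eq_corner_curve:
  "corner_arc (1/2) (\<i>/2) \<union> stub (1/2) \<union> stub (\<i>/2) = corner_curve 1 (1/2)"
proof -
  have *: "x \<in> corner_curve 1 (1/2) \<longleftrightarrow> x \<in> corner_curve (1/2) (1/2) \<or>
      snd x = 0 \<and> 1/2 \<le> \<bar>Re (fst x) - Im (fst x)\<bar> \<and> \<bar>Re (fst x) - Im (fst x)\<bar> \<le> 1 \<and>
      Re (fst x) + Im (fst x) = \<bar>Re (fst x) - Im (fst x)\<bar>" for x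
    using corner_graph_outside[of "1/2" "Re (fst x) - Im (fst x)"]
    by (cases "\<bar>Re (fst x) - Im (fst x)\<bar> \<le> 1/2"; cases "1/2 \<le> \<bar>Re (fst x) - Im (fst x)\<bar>")
      (auto simp: corner_curve_def case_prod_unfold)
  show ?thesis
    unfolding corner_arc_eq_corner_curve stub_right stub_top
    by (rule set_eqI, unfold *) (auto simp: abs_if split: if_splits)
qed

lemma supported_move_arc_tile:
  "supported_move (open_diamond \<inter> {(z, h). Re z + Im z > 0})
     (corner_arc (1/2) (\<i>/2) \<union> stub (1/2) \<union> stub (\<i>/2)) (double ` corner_arc (1/2) (\<i>/2))"
  unfolding arc_stubs_eq_corner_curve double_corner_arc_eq_corner_curve
  by (rule supported_move_corner_curve_diamond)

lemma supported_move_arc_joint: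
  "supported_move open_square (spoke (1/2) \<union> spoke (\<i>/2)) (corner_arc (1/2) (\<i>/2))"
  unfolding spokes_eq_corner_curve corner_arc_eq_corner_curve
  by (rule supported_move_corner_curve_square)

text \<open>The shear is vertical. The two height functions agree over the imaginary axis, so the under-strand
  of the crossing is not moved, and the term in \<open>Im z\<close> makes them agree outside the diamond.\<close>

lemma supported_move_over_strand:
  "supported_move (open_diamond \<inter> {(z, h). Re z \<noteq> 0})
     (over_strand (1/2) \<union> stub (1/2) \<union> stub (-1/2)) (double ` over_strand (1/2))"
proof -
  define r :: "complex \<times> real \<Rightarrow> real" where "r = (\<lambda>x. max 0 (1/2 - \<bar>Re (fst x)\<bar>))"
  define s :: "complex \<times> real \<Rightarrow> real" where
    "s = (\<lambda>x. max (r x) ((1 - \<bar>Re (fst x)\<bar> - \<bar>Im (fst x)\<bar>) / 2))"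
  define C :: "(complex \<times> real) set" where "C = {x. Im (fst x) = 0 \<and> \<bar>Re (fst x)\<bar> \<le> 1}"
  have "supported_move (open_diamond \<inter> {(z, h). Re z \<noteq> 0}) {x \<in> C. snd x = r x} {x \<in> C. snd x = s x}"
  proof (rule supported_move_shear[where e = "(0, 1)" and B = "1/2"])
    show "continuous_on UNIV (snd :: complex \<times> real \<Rightarrow> real)" by (intro continuous_intros)
    show cr: "continuous_on UNIV r" unfolding r_def by (intro continuous_intros continuous_on_max)
    show "continuous_on UNIV s" unfolding s_def by (intro continuous_intros continuous_on_max cr) auto
    show "s x - r x \<le> 1/2" for x
      using abs_ge_zero[of "Re (fst x)"] abs_ge_zero[of "Im (fst x)"]
      unfolding s_def r_def max_def by argo
  qed (auto simp: r_def s_def C_def open_diamond_def max_def split: if_splits)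
  moreover have seg: "closed_segment (-(1/2)) (1/2) = {z :: complex. Im z = 0 \<and> -1/2 \<le> Re z \<and> Re z \<le> 1/2}"
    using closed_segment_real_axis[of "-1/2" "1/2"] by simp
  have cm: "Im z = 0 \<Longrightarrow> cmod z = \<bar>Re z\<bar>" for z by (simp add: cmod_def)
  have mem_over: "(z, h) \<in> over_strand (1/2) \<longleftrightarrow> Im z = 0 \<and> \<bar>Re z\<bar> \<le> 1/2 \<and> h = 1/2 - \<bar>Re z\<bar>" for z h
    unfolding over_strand_def seg using cm[of z] by (auto simp: cm abs_le_iff)
  have "{x \<in> C. snd x = r x} = over_strand (1/2) \<union> stub (1/2) \<union> stub (-1/2)"
    unfolding stub_right stub_left
    by (auto simp: C_def r_def max_def mem_over)
  moreover have "{x \<in> C. snd x = s x} = double ` over_strand (1/2)"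
  proof (intro subset_antisym subsetI)
    fix x assume x: "x \<in> {x \<in> C. snd x = s x}"
    then have "x = double (fst x / 2, 1/2 - cmod (fst x / 2))"
      by (cases x) (auto simp: C_def s_def r_def double_def cm max_def abs_if split: if_splits)
    moreover have "fst x / 2 \<in> closed_segment (-(1/2)) (1/2)"
      using x by (auto simp: seg C_def)
    ultimately show "x \<in> double ` over_strand (1/2)" unfolding over_strand_def by blast
  next
    fix x assume "x \<in> double ` over_strand (1/2)"
    then show "x \<in> {x \<in> C. snd x = s x}"
      unfolding over_strand_def seg
      by (auto simp: double_def C_def s_def r_def cm max_def abs_if split: if_splits)
  qed
  ultimately show ?thesis by simp
qed

section \<open>The moves for all tiles\<close>

lemma double_turn: "double ` turn c ` X = turn c ` double ` X"
  by (simp add: image_image double_def turn_def case_prod_unfold mult.left_commute)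

lemma turn_turn: "turn a ` turn b ` X = turn (a * b) ` X"
  by (simp add: image_image turn_def case_prod_unfold mult.assoc)

lemma turn_1: "turn 1 ` X = X"
  by (simp add: turn_def case_prod_unfold)

lemma turn_segment: "turn c ` (closed_segment a b \<times> {0}) = closed_segment (c * a) (c * b) \<times> {0}"
proof -
  have "turn c ` (S \<times> {0}) = ((*) c ` S) \<times> {0}" for S
    by (force simp: turn_def)
  moreover have "(*) c ` closed_segment a b = closed_segment (c * a) (c * b)"
    by (rule closed_segment_linear_image[symmetric]) (rule linear_times)
  ultimately show ?thesis by simp
qed

lemma turn_stub: "turn c ` stub d = stub (c * d)"
  by (simp add: stub_def turn_segment mult.left_commute)

lemma turn_spoke: "turn c ` spoke d = spoke (c * d)"
  by (simp add: spoke_def turn_segment)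

lemma turn_flat_strand: "turn c ` flat_strand d = flat_strand (c * d)"
  by (simp add: flat_strand_def turn_segment)

lemma turn_over_strand:
  assumes "cmod c = 1"
  shows "turn c ` over_strand d = over_strand (c * d)"
proof -
  have seg: "(*) c ` closed_segment (-d) d = closed_segment (- (c * d)) (c * d)"
    using closed_segment_linear_image[OF linear_times[of c], of "-d" d] by simp
  then show ?thesis
    using assms by (simp add: over_strand_def turn_def image_image norm_mult flip: seg)
qed

text \<open>The four powers of \<open>\<i>\<close> are the rotations that preserve the unit square.\<close>

lemma turn_corner_arc:
  assumes c: "c \<in> {1, \<i>, -1, -\<i>}"
  shows "turn c ` corner_arc a b = corner_arc (c * a) (c * b)"
proof -
  have sub: "turn c ` corner_arc a b \<subseteq> corner_arc (c * a) (c * b)" if c: "c \<in> {1, \<i>, -1, -\<i>}" for a b c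
  proof -
    have "c * z \<in> unit_square" if "z \<in> unit_square" for z
      using c that by (auto simp: unit_square_def)
    moreover have "cmod (c * z - (c * a + c * b)) = cmod (z - (a + b))" for z
    proof -
      have "cmod (c * z - (c * a + c * b)) = cmod c * cmod (z - (a + b))"
        by (simp add: algebra_simps flip: norm_mult)
      moreover have "cmod c = 1" using c by auto
      ultimately show ?thesis by simp
    qed
    ultimately show ?thesis by (auto simp: corner_arc_def turn_def)
  qed
  define c' where "c' = cnj c"
  have c': "c' \<in> {1, \<i>, -1, -\<i>}" "c * c' = 1" "c' * c = 1"
    using c by (auto simp: c'_def)
  have "corner_arc (c * a) (c * b) = turn c ` turn c' ` corner_arc (c * a) (c * b)"
    by (simp add: turn_turn c' turn_1)
  also have "\<dots> \<subseteq> turn c ` corner_arc (c' * (c * a)) (c' * (c * b))"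
    by (intro image_mono sub c')
  also have "\<dots> = turn c ` corner_arc a b"
    by (simp add: mult.assoc[symmetric] c')
  finally show ?thesis using sub[OF c] by blast
qed

lemma turn_open_diamond: "c \<in> {1, \<i>, -1, -\<i>} \<Longrightarrow> turn c ` open_diamond \<subseteq> open_diamond"
  by (auto simp: turn_def open_diamond_def)

lemma turn_open_square: "c \<in> {1, \<i>, -1, -\<i>} \<Longrightarrow> turn c ` open_square \<subseteq> open_square"
  by (auto simp: turn_def open_square_def)

text \<open>This is the pattern of the tile, prolonged to the points where the doubled pattern ends.\<close>

definition with_stubs :: "tile \<Rightarrow> (complex \<times> real) set" where
  "with_stubs \<tau> = edge_pattern \<tau> \<union> (\<Union>d\<in>edge_endpoints \<tau>. stub d)"

lemma with_stubs_turn: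
  assumes "edge_pattern \<tau> = turn c ` edge_pattern \<sigma>" "edge_endpoints \<tau> = (*) c ` edge_endpoints \<sigma>"
  shows "with_stubs \<tau> = turn c ` with_stubs \<sigma>"
  unfolding with_stubs_def assms by (simp add: image_Un image_UN turn_stub)

lemma supported_move_turned_tile:
  assumes "supported_move open_diamond (with_stubs \<sigma>) (double ` edge_pattern \<sigma>)"
    and c: "c \<in> {1, \<i>, -1, -\<i>}"
    and "edge_pattern \<tau> = turn c ` edge_pattern \<sigma>" "edge_endpoints \<tau> = (*) c ` edge_endpoints \<sigma>"
  shows "supported_move open_diamond (with_stubs \<tau>) (double ` edge_pattern \<tau>)"
proof -
  have "cmod c = 1" using c by auto
  with assms(1) have "supported_move (turn c ` open_diamond)
      (turn c ` with_stubs \<sigma>) (turn c ` double ` edge_pattern \<sigma>)"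
    by (rule supported_move_turn)
  then show ?thesis
    unfolding with_stubs_turn[OF assms(3,4)] unfolding assms(3) double_turn
    by (rule supported_move_mono) (rule turn_open_diamond[OF c])
qed

text \<open>Up to a rotation there is one arc, one straight segment, one pair of arcs and one crossing. Straight
  segments need no motion, since doubling a segment amounts to prolonging it by stubs. A pair of arcs
  is moved by two shears on opposite sides of the antidiagonal.\<close>

lemma supported_move_tile:
  "supported_move open_diamond (with_stubs \<tau>) (double ` edge_pattern \<tau>)"
proof -
  let ?P = "\<lambda>\<tau>. supported_move open_diamond (with_stubs \<tau>) (double ` edge_pattern \<tau>)"
  let ?H = "open_diamond \<inter> {(z, h). Re z + Im z > 0}"
  let ?A = "corner_arc (1/2) (\<i>/2) \<union> stub (1/2) \<union> stub (\<i>/2)"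
  let ?B = "double ` corner_arc (1/2) (\<i>/2)"
  have flat: "double ` flat_strand d = flat_strand d \<union> stub d \<union> stub (-d)" for d
  proof -
    have "double ` (S \<times> {0}) = ((*) 2 ` S) \<times> {0}" for S by (force simp: double_def)
    moreover have "(*) 2 ` closed_segment (-d) d = closed_segment (-(2*d)) (2 * d)"
      using closed_segment_linear_image[OF linear_times[of "2 :: complex"], of "-d" d] by simp
    ultimately have "double ` flat_strand d = closed_segment (-(2*d)) (2 * d) \<times> {0}"
      by (simp add: flat_strand_def)
    \<comment> \<open>The points \<open>- d\<close> and \<open>d\<close> cut the segment from \<open>- 2 * d\<close> to \<open>2 * d\<close> into three pieces.\<close>
    moreover have "closed_segment (-(2*d)) (2*d) = closed_segment (-(2*d)) (-d) \<union> closed_segment (-d) (2*d)"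
      by (rule Un_closed_segment[symmetric]) (auto simp: in_segment intro!: exI[of _ "1/4"] simp: scaleR_conv_of_real algebra_simps)
    moreover have "closed_segment (-d) (2*d) = closed_segment (-d) d \<union> closed_segment d (2*d)"
      by (rule Un_closed_segment[symmetric]) (auto simp: in_segment intro!: exI[of _ "2/3"] simp: scaleR_conv_of_real algebra_simps)
    ultimately show ?thesis
      by (auto simp: flat_strand_def stub_def closed_segment_commute)
  qed
  have T0: "?P T0" by (simp add: with_stubs_def supported_move_refl)
  have "supported_move open_diamond ?A ?B"
    by (rule supported_move_mono[OF supported_move_arc_tile]) blast
  then have T3: "?P T3" by (simp add: with_stubs_def Un_assoc)
  have T5: "?P T5"
    using supported_move_refl[of open_diamond "double ` flat_strand (1/2)"]
    unfolding flat by (simp add: flat with_stubs_def Un_ac)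
  have T7: "?P T7"
  proof -
    have *: "supported_move (turn (-1) ` ?H) (turn (-1) ` ?A) (turn (-1) ` ?B)"
      by (rule supported_move_turn[OF supported_move_arc_tile]) simp
    have pos: "corner_graph 1 v > 0" "corner_graph (1/2) v > 0" for v
      using corner_graph_half_lower[of v] corner_graph_half_le_one[of v] by linarith+
    have B: "?B \<subseteq> {(z, h). Re z + Im z > 0}" and A: "?A \<subseteq> {(z, h). Re z + Im z > 0}"
      unfolding arc_stubs_eq_corner_curve double_corner_arc_eq_corner_curve corner_curve_def
      by (auto simp: pos)
    have "supported_move (turn (-1) ` ?H \<union> ?H) (turn (-1) ` ?A \<union> ?A) (turn (-1) ` ?B \<union> ?B)"
    proof (rule supported_move_Un[OF * supported_move_arc_tile])
      show "?A \<inter> turn (-1) ` ?H = {}" using A by (force simp: turn_def)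
      show "turn (-1) ` ?B \<inter> ?H = {}" using B by (fastforce simp: turn_def)
    qed
    then have "supported_move open_diamond (turn (-1) ` ?A \<union> ?A) (turn (-1) ` ?B \<union> ?B)"
      by (rule supported_move_mono) (use turn_open_diamond[of "-1"] in blast)
    moreover have "turn (-1) ` ?A \<union> ?A = with_stubs T7"
      by (auto simp: with_stubs_def image_Un turn_stub turn_corner_arc)
    moreover have "turn (-1) ` ?B \<union> ?B = double ` edge_pattern T7"
      by (simp add: image_Un double_turn[symmetric] turn_corner_arc)
    ultimately show ?thesis by simp
  qed
  have T9: "?P T9"
  proof -
    let ?V = "flat_strand (\<i>/2) \<union> stub (\<i>/2) \<union> stub (-(\<i>/2))"
    have V: "?V = closed_segment (-\<i>) \<i> \<times> {0}"
    proof -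
      have "double ` flat_strand (\<i>/2) = closed_segment (-\<i>) \<i> \<times> {0}"
        using closed_segment_linear_image[OF linear_times[of "2 :: complex"], of "-(\<i>/2)" "\<i>/2"]
        by (force simp: flat_strand_def double_def)
      then show ?thesis by (simp add: flat)
    qed
    have "Re z = 0" if "z \<in> closed_segment (-\<i>) \<i>" for z
      using that by (auto simp: in_segment)
    then have "?V \<inter> (open_diamond \<inter> {(z, h). Re z \<noteq> 0}) = {}" unfolding V by auto
    then have "supported_move (open_diamond \<inter> {(z, h). Re z \<noteq> 0} \<union> {})
        (over_strand (1/2) \<union> stub (1/2) \<union> stub (-1/2) \<union> ?V) (double ` over_strand (1/2) \<union> ?V)"
      by (intro supported_move_Un supported_move_over_strand supported_move_refl) auto
    then have "supported_move open_diamond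
        (over_strand (1/2) \<union> stub (1/2) \<union> stub (-1/2) \<union> ?V) (double ` over_strand (1/2) \<union> ?V)"
      by (rule supported_move_mono) auto
    moreover have "over_strand (1/2) \<union> stub (1/2) \<union> stub (-1/2) \<union> ?V = with_stubs T9"
      by (auto simp: with_stubs_def)
    moreover have "double ` over_strand (1/2) \<union> ?V = double ` edge_pattern T9"
      by (simp add: image_Un flat)
    ultimately show ?thesis by simp
  qed
  show ?thesis
  proof (cases \<tau>)
    case T1
    show ?thesis unfolding T1 by (rule supported_move_turned_tile[OF T3, of "-1"]) (auto simp: turn_corner_arc)
  next
    case T2
    show ?thesis unfolding T2 by (rule supported_move_turned_tile[OF T3, of "-\<i>"]) (auto simp: turn_corner_arc)
  next
    case T4
    show ?thesis unfolding T4 by (rule supported_move_turned_tile[OF T3, of "\<i>"]) (auto simp: turn_corner_arc)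
  next
    case T6
    show ?thesis unfolding T6 by (rule supported_move_turned_tile[OF T5, of "\<i>"]) (auto simp: turn_flat_strand)
  next
    case T8
    show ?thesis unfolding T8 by (rule supported_move_turned_tile[OF T7, of "\<i>"]) (auto simp: turn_corner_arc image_Un)
  next
    case T10
    have "flat_strand (-(1/2)) = flat_strand (1/2)" by (simp add: flat_strand_def closed_segment_commute)
    then show ?thesis unfolding T10
      by (intro supported_move_turned_tile[OF T9, of "\<i>"]) (auto simp: turn_flat_strand turn_over_strand image_Un)
  qed (use T0 T3 T5 T7 T9 in auto)
qed

text \<open>At most two stubs arrive at a vertex, so a tile with at most one curve suffices to continue them.\<close>

definition joint_tiles :: "tile set" where
  "joint_tiles = {T0, T1, T2, T3, T4, T5, T6}"

text \<open>Two spokes at a right angle are rounded to an arc; two opposite spokes form a straight segment.\<close>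

lemma supported_move_joint:
  assumes "\<tau> \<in> joint_tiles"
  shows "supported_move open_square (\<Union>d\<in>edge_endpoints \<tau>. spoke d) (edge_pattern \<tau>)"
proof -
  have flat: "spoke (-d) \<union> spoke d = flat_strand d" for d
  proof -
    have "closed_segment (-d) d = closed_segment (-d) 0 \<union> closed_segment 0 d"
      by (rule Un_closed_segment[symmetric]) (auto simp: in_segment intro!: exI[of _ "1/2"])
    then show ?thesis by (auto simp: spoke_def flat_strand_def closed_segment_commute)
  qed
  have arc: "supported_move open_square (spoke (c * (1/2)) \<union> spoke (c * (\<i>/2))) (corner_arc (c * (1/2)) (c * (\<i>/2)))"
    if c: "c \<in> {1, \<i>, -1, -\<i>}" for c
  proof -
    have "cmod c = 1" using c by auto
    from supported_move_turn[OF supported_move_arc_joint this]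
    have "supported_move (turn c ` open_square) (spoke (c * (1/2)) \<union> spoke (c * (\<i>/2))) (corner_arc (c * (1/2)) (c * (\<i>/2)))"
      by (simp only: image_Un turn_spoke turn_corner_arc[OF c])
    then show ?thesis by (rule supported_move_mono) (rule turn_open_square[OF c])
  qed
  show ?thesis
  proof (cases \<tau>)
    case T0 then show ?thesis by (simp add: supported_move_refl)
  next
    case T1 then show ?thesis using arc[of "-1"] by simp
  next
    case T2 then show ?thesis using arc[of "-\<i>"] by simp
  next
    case T3 then show ?thesis using arc[of 1] by simp
  next
    case T4 then show ?thesis using arc[of \<i>] by simp
  next
    case T5 then show ?thesis using flat[of "1/2"] by (simp add: supported_move_refl)
  next
    case T6 then show ?thesis using flat[of "\<i>/2"] by (simp add: supported_move_refl)
  qed (use assms in \<open>auto simp: joint_tiles_def\<close>)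
qed

section \<open>Endpoints and positions of the tiles\<close>

definition directions :: "complex set" where
  "directions = {-1/2, 1/2, -\<i>/2, \<i>/2}"

lemma edge_endpoints_subset: "edge_endpoints \<tau> \<subseteq> directions"
  by (cases \<tau>) (auto simp: directions_def)

lemma directions_minus: "d \<in> directions \<Longrightarrow> - d \<in> directions"
  by (auto simp: directions_def)

lemma edge_endpoints_empty_iff: "edge_endpoints \<tau> = {} \<longleftrightarrow> \<tau> = T0"
  by (cases \<tau>) auto

lemma finite_edge_endpoints: "finite (edge_endpoints \<tau>)"
  by (rule finite_subset[OF edge_endpoints_subset]) (simp add: directions_def)

lemma card_edge_endpoints_le: "card (edge_endpoints \<tau>) \<le> 4"
proof -
  have "card (edge_endpoints \<tau>) \<le> card directions"
    by (rule card_mono[OF _ edge_endpoints_subset]) (simp add: directions_def)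
  also have "\<dots> \<le> 4" unfolding directions_def by (simp add: card_insert_if)
  finally show ?thesis .
qed

lemma card_edge_endpoints_le_2:
  assumes "d \<in> directions" "d \<notin> edge_endpoints \<tau>"
  shows "card (edge_endpoints \<tau>) \<le> 2"
  using assms by (cases \<tau>) (auto simp: directions_def card_insert_if)

text \<open>Any two midpoints of sides are joined by exactly one of the tiles \<open>T1\<close> to \<open>T6\<close>.\<close>

lemma obtain_joint_tile:
  assumes "D \<subseteq> directions" "card D \<in> {0, 2}"
  obtains \<tau> where "\<tau> \<in> joint_tiles" "edge_endpoints \<tau> = D"
proof -
  have fin: "finite D" by (rule finite_subset[OF assms(1)]) (simp add: directions_def)
  consider "D = {}" | x y where "D = {x, y}" "x \<noteq> y"
    using assms(2) fin by (auto simp: card_2_iff)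
  then have "\<exists>\<tau>\<in>joint_tiles. edge_endpoints \<tau> = D"
  proof cases
    case 1
    then show ?thesis by (intro bexI[of _ T0]) (auto simp: joint_tiles_def)
  next
    case 2
    then have "x \<in> directions" "y \<in> directions" using assms(1) by auto
    then show ?thesis
      unfolding directions_def joint_tiles_def 2(1) using 2(2)
      by (elim insertE emptyE) (simp_all add: doubleton_eq_iff)
  qed
  then show ?thesis using that by blast
qed

definition closed_square :: "(complex \<times> real) set" where
  "closed_square = {(z, h). \<bar>Re z\<bar> \<le> 1/2 \<and> \<bar>Im z\<bar> \<le> 1/2}"

definition closed_diamond :: "(complex \<times> real) set" where
  "closed_diamond = {(z, h). \<bar>Re z\<bar> + \<bar>Im z\<bar> \<le> 1}"

lemma closed_square_subset_closed_diamond: "closed_square \<subseteq> closed_diamond"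
  by (auto simp: closed_square_def closed_diamond_def)

text \<open>Each direction has length 1/2 in the sum norm.\<close>

lemma multiple_of_direction:
  assumes "d \<in> directions" "\<bar>t\<bar> \<le> r"
  shows "\<bar>Re (t *\<^sub>R d)\<bar> + \<bar>Im (t *\<^sub>R d)\<bar> \<le> r / 2"
proof -
  have "\<bar>Re d\<bar> + \<bar>Im d\<bar> = 1/2"
    using assms(1) unfolding directions_def by (elim insertE emptyE) (hypsubst, simp)+
  then have "\<bar>Re (t *\<^sub>R d)\<bar> + \<bar>Im (t *\<^sub>R d)\<bar> = \<bar>t\<bar> * (1/2)"
    by (simp add: abs_mult flip: distrib_left)
  then show ?thesis using assms(2) by simp
qed

lemma segment_through_centre:
  assumes "d \<in> directions" "z \<in> closed_segment (-d) d"
  shows "\<bar>Re z\<bar> \<le> 1/2 \<and> \<bar>Im z\<bar> \<le> 1/2"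
proof -
  obtain u where u: "0 \<le> u" "u \<le> 1" "z = (1 - u) *\<^sub>R (- d) + u *\<^sub>R d"
    using assms(2) by (auto simp only: in_segment)
  have z: "z = (2 * u - 1) *\<^sub>R d" unfolding u(3) by (simp add: scaleR_conv_of_real algebra_simps)
  have "\<bar>2 * u - 1\<bar> \<le> 1" using u(1,2) by linarith
  from multiple_of_direction[OF assms(1) this] show ?thesis unfolding z by linarith
qed

lemma edge_pattern_subset: "edge_pattern \<tau> \<subseteq> closed_square"
proof -
  have "corner_arc a b \<subseteq> closed_square" for a b
    by (auto simp: corner_arc_def unit_square_def closed_square_def)
  moreover have "flat_strand d \<subseteq> closed_square" if "d \<in> directions" for d
    using segment_through_centre[OF that] by (auto simp: flat_strand_def closed_square_def)
  moreover have "over_strand d \<subseteq> closed_square" if "d \<in> directions" for d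
    using segment_through_centre[OF that] by (auto simp: over_strand_def closed_square_def)
  moreover have "1/2 \<in> directions" "\<i>/2 \<in> directions" by (auto simp: directions_def)
  ultimately show ?thesis by (cases \<tau>) simp_all
qed

lemma spoke_subset:
  assumes "d \<in> directions"
  shows "spoke d \<subseteq> closed_square"
proof -
  have "\<bar>Re (u *\<^sub>R d)\<bar> \<le> 1/2 \<and> \<bar>Im (u *\<^sub>R d)\<bar> \<le> 1/2" if "0 \<le> u" "u \<le> 1" for u
    using multiple_of_direction[OF assms, of u 1] that by auto
  then show ?thesis by (auto simp: spoke_def closed_square_def in_segment)
qed

lemma stub_subset:
  assumes "d \<in> directions"
  shows "stub d \<subseteq> closed_diamond"
proof -
  have "\<bar>Re ((1 + u) *\<^sub>R d)\<bar> + \<bar>Im ((1 + u) *\<^sub>R d)\<bar> \<le> 1" if "0 \<le> u" "u \<le> 1" for u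
    using multiple_of_direction[OF assms, of "1 + u" 2] that by simp
  moreover have "(1 - u) *\<^sub>R d + u *\<^sub>R (2 * d) = (1 + u) *\<^sub>R d" for u
    by (simp add: scaleR_conv_of_real algebra_simps)
  ultimately show ?thesis by (auto simp only: stub_def closed_diamond_def in_segment)
qed

lemma with_stubs_subset: "with_stubs \<tau> \<subseteq> closed_diamond"
  unfolding with_stubs_def
  using edge_pattern_subset closed_square_subset_closed_diamond stub_subset edge_endpoints_subset by blast

lemma double_edge_pattern_subset: "double ` edge_pattern \<tau> \<subseteq> closed_diamond"
  by (rule supported_move_subset[OF supported_move_sym[OF supported_move_tile] with_stubs_subset])
    (auto simp: open_diamond_def closed_diamond_def)

lemma centre_eq_iff: "centre x y = centre x' y' \<longleftrightarrow> x = x' \<and> y = y'"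
  by (auto simp: centre_def complex_eq_iff)

lemma squares_disjoint:
  assumes "centre x y \<noteq> centre x' y'"
  shows "place (centre x y) ` closed_square \<inter> place (centre x' y') ` open_square = {}"
proof -
  have False if "centre x y + z = centre x' y' + z'"
    "\<bar>Re z\<bar> \<le> 1/2" "\<bar>Im z\<bar> \<le> 1/2" "\<bar>Re z'\<bar> < 1/2" "\<bar>Im z'\<bar> < 1/2" for z z'
  proof -
    have "real x + Re z = real x' + Re z'" "real y + Im z = real y' + Im z'"
      using that(1) by (simp_all add: centre_def complex_eq_iff)
    then have "\<bar>real x - real x'\<bar> < 1" "\<bar>real y - real y'\<bar> < 1" using that(2-) by linarith+
    then have "x = x'" "y = y'" by linarith+
    then show False using assms by simp
  qed
  then show ?thesis
    unfolding place_def closed_square_def open_square_def by fastforce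
qed

lemma place_segment: "place c ` (closed_segment a b \<times> {0}) = closed_segment (c + a) (c + b) \<times> {0}"
  unfolding closed_segment_translation by (force simp: place_def)

lemma UN_restrict:
  "T \<subseteq> S \<Longrightarrow> (\<And>s. s \<in> S \<Longrightarrow> s \<notin> T \<Longrightarrow> F s = {}) \<Longrightarrow> (\<Union>s\<in>S. F s) = (\<Union>s\<in>T. F s)"
  by blast

lemma mosaic_curves_eq:
  "mosaic_curves pattern m n M =
     (\<Union>p\<in>{..<m} \<times> {..<n}. place (centre (fst p) (snd p)) ` pattern (M (fst p) (snd p)))"
  unfolding mosaic_curves_def place_def by fastforce

section \<open>The edge mosaic of a corner mosaic\<close>

locale corner_diagram =
  fixes m n :: nat and M :: "nat \<Rightarrow> nat \<Rightarrow> tile"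
  assumes mosaic: "corner_mosaic m n M"
begin

definition tiles :: "(nat \<times> nat) set" where
  "tiles = {..<m} \<times> {..<n}"

definition vertices :: "(nat \<times> nat) set" where
  "vertices = {..m} \<times> {..n}"

definition tile_at :: "nat \<times> nat \<Rightarrow> tile" where
  "tile_at p = M (fst p) (snd p)"

text \<open>Multiplication by \<open>1 + \<i>\<close> takes the centre of the square \<open>(i, j)\<close> to \<open>(i - j) + (i + j) \<i>\<close>.
  The shift by \<open>n + \<i>\<close> makes all coordinates that occur natural numbers, also those of the
  vertices.\<close>

definition tile_spot :: "nat \<times> nat \<Rightarrow> nat \<times> nat" where
  "tile_spot p = (fst p + n - snd p, fst p + snd p + 1)"

definition vertex_spot :: "nat \<times> nat \<Rightarrow> nat \<times> nat" where
  "vertex_spot q = (fst q + n - snd q, fst q + snd q)"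

definition tile_centre :: "nat \<times> nat \<Rightarrow> complex" where
  "tile_centre p = centre (fst (tile_spot p)) (snd (tile_spot p))"

definition vertex_centre :: "nat \<times> nat \<Rightarrow> complex" where
  "vertex_centre q = centre (fst (vertex_spot q)) (snd (vertex_spot q))"

text \<open>The directions from the vertex \<open>q\<close> towards the tiles with a curve that ends at \<open>q\<close>. The centres
  of these tiles are at distance 1, while directions have length 1/2.\<close>

definition ends :: "nat \<times> nat \<Rightarrow> complex set" where
  "ends q = {d \<in> directions. \<exists>p\<in>tiles. tile_centre p = vertex_centre q + 2 * d \<and> - d \<in> edge_endpoints (tile_at p)}"

definition joint :: "nat \<times> nat \<Rightarrow> tile" where
  "joint q = (SOME \<tau>. \<tau> \<in> joint_tiles \<and> edge_endpoints \<tau> = ends q)"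

definition grid_size :: nat where
  "grid_size = m + n + 1"

definition edge_grid :: "nat \<Rightarrow> nat \<Rightarrow> tile" where
  "edge_grid x y =
     (if (x, y) \<in> tile_spot ` tiles then tile_at (inv_into tiles tile_spot (x, y))
      else if (x, y) \<in> vertex_spot ` vertices then joint (inv_into vertices vertex_spot (x, y))
      else T0)"

lemma finite_tiles: "finite tiles" and finite_vertices: "finite vertices"
  by (simp_all add: tiles_def vertices_def)

lemma tile_centre_eq:
  assumes "p \<in> tiles"
  shows "Re (tile_centre p) = real (fst p) + real n - real (snd p)"
    "Im (tile_centre p) = real (fst p) + real (snd p) + 1"
  using assms by (auto simp: tile_centre_def tile_spot_def centre_def tiles_def of_nat_diff)

lemma vertex_centre_eq:
  assumes "q \<in> vertices"
  shows "Re (vertex_centre q) = real (fst q) + real n - real (snd q)"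
    "Im (vertex_centre q) = real (fst q) + real (snd q)"
  using assms by (auto simp: vertex_centre_def vertex_spot_def centre_def vertices_def of_nat_diff)

lemma inj_tile_spot: "inj_on tile_spot tiles"
  by (rule inj_onI) (auto simp: tile_spot_def tiles_def)

lemma inj_vertex_spot: "inj_on vertex_spot vertices"
  by (rule inj_onI) (auto simp: vertex_spot_def vertices_def)

lemma spots_disjoint:
  assumes "p \<in> tiles" "q \<in> vertices"
  shows "tile_spot p \<noteq> vertex_spot q"
proof
  assume "tile_spot p = vertex_spot q"
  then have "fst p + n - snd p = fst q + n - snd q" "fst p + snd p + 1 = fst q + snd q"
    by (simp_all add: tile_spot_def vertex_spot_def)
  moreover have "snd p < n" "snd q \<le> n" using assms by (auto simp: tiles_def vertices_def)
  ultimately have "fst p + snd q = fst q + snd p" "fst p + snd p + 1 = fst q + snd q" by linarith+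
  then have "2 * fst p + 1 = 2 * fst q" by linarith
  then show False by presburger
qed

lemma spots_in_grid:
  "tile_spot ` tiles \<subseteq> {..<grid_size} \<times> {..<grid_size}" "vertex_spot ` vertices \<subseteq> {..<grid_size} \<times> {..<grid_size}"
  by (auto simp: tile_spot_def vertex_spot_def tiles_def vertices_def grid_size_def)

lemma inj_tile_centre: "inj_on tile_centre tiles"
  by (rule inj_onI, rule inj_onD[OF inj_tile_spot])
    (auto simp only: tile_centre_def centre_eq_iff intro: prod_eqI)

lemma inj_vertex_centre: "inj_on vertex_centre vertices"
  by (rule inj_onI, rule inj_onD[OF inj_vertex_spot])
    (auto simp only: vertex_centre_def centre_eq_iff intro: prod_eqI)

lemma centres_distinct: "p \<in> tiles \<Longrightarrow> q \<in> vertices \<Longrightarrow> tile_centre p \<noteq> vertex_centre q"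
  using spots_disjoint by (auto simp: tile_centre_def vertex_centre_def centre_eq_iff prod_eq_iff)

lemma tile_centre_rotation:
  assumes "p \<in> tiles"
  shows "tile_centre p = (1 + \<i>) * centre (fst p) (snd p) + (of_nat n + \<i>)"
  using tile_centre_eq[OF assms] by (simp add: complex_eq_iff centre_def)

lemma vertex_centre_rotation:
  assumes "q \<in> vertices"
  shows "vertex_centre q = (1 + \<i>) * (centre (fst q) (snd q) - (1 + \<i>) / 2) + (of_nat n + \<i>)"
  using vertex_centre_eq[OF assms] by (simp add: complex_eq_iff centre_def)

text \<open>The tiles counted in the definition of a corner mosaic correspond to the directions in which they
  are seen from the vertex in the rotated picture.\<close>

lemma card_ends:
  assumes q: "q \<in> vertices"
  shows "card (ends q) \<in> {0, 2}"
proof -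
  let ?V = "centre (fst q) (snd q) - (1 + \<i>) / 2"
  let ?S = "{(i, j). i < m \<and> j < n \<and> (\<exists>p\<in>corner_endpoints (M i j). centre i j + p = ?V)}"
  have rot: "centre (fst p) (snd p) + (1 - \<i>) * z = ?V \<longleftrightarrow> tile_centre p + 2 * z = vertex_centre q"
    if "p \<in> tiles" for p z
  proof -
    have "tile_centre p + 2 * z - vertex_centre q
        = (1 + \<i>) * (centre (fst p) (snd p) + (1 - \<i>) * z - ?V)"
      unfolding tile_centre_rotation[OF that] vertex_centre_rotation[OF q]
      by (simp add: algebra_simps)
    moreover have "(1 + \<i>) \<noteq> 0" by (simp add: complex_eq_iff)
    ultimately show ?thesis by (metis eq_iff_diff_eq_0 mult_eq_0_iff)
  qed
  have "?S = {p \<in> tiles. \<exists>z\<in>edge_endpoints (tile_at p). centre (fst p) (snd p) + (1 - \<i>) * z = ?V}"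
    by (auto simp: tiles_def tile_at_def corner_endpoints_def)
  also have "\<dots> = {p \<in> tiles. \<exists>z\<in>edge_endpoints (tile_at p). tile_centre p + 2 * z = vertex_centre q}"
    using rot by auto
  finally have S: "?S = {p \<in> tiles. \<exists>z\<in>edge_endpoints (tile_at p). tile_centre p + 2 * z = vertex_centre q}" .
  have "bij_betw (\<lambda>p. (tile_centre p - vertex_centre q) / 2) ?S (ends q)"
    unfolding bij_betw_def
  proof
    show "inj_on (\<lambda>p. (tile_centre p - vertex_centre q) / 2) ?S"
      using inj_tile_centre unfolding S inj_on_def by auto
    show "(\<lambda>p. (tile_centre p - vertex_centre q) / 2) ` ?S = ends q"
    proof (intro subset_antisym subsetI)
      fix d assume "d \<in> (\<lambda>p. (tile_centre p - vertex_centre q) / 2) ` ?S"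
      then obtain p z where p: "p \<in> tiles" "z \<in> edge_endpoints (tile_at p)"
        "tile_centre p + 2 * z = vertex_centre q" "d = (tile_centre p - vertex_centre q) / 2"
        unfolding S by auto
      have "d = - z" unfolding p(4) p(3)[symmetric] by simp
      then show "d \<in> ends q"
        using p(1,2) edge_endpoints_subset directions_minus
        by (auto simp: ends_def simp flip: p(3) intro!: bexI[of _ p])
    next
      fix d assume "d \<in> ends q"
      then obtain p where p: "p \<in> tiles" "tile_centre p = vertex_centre q + 2 * d" "- d \<in> edge_endpoints (tile_at p)"
        by (auto simp: ends_def)
      then have "p \<in> ?S" unfolding S by (auto intro!: bexI[of _ "- d"])
      moreover have "d = (tile_centre p - vertex_centre q) / 2" unfolding p(2) by simp
      ultimately show "d \<in> (\<lambda>p. (tile_centre p - vertex_centre q) / 2) ` ?S" by blast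
    qed
  qed
  then have "card ?S = card (ends q)" by (rule bij_betw_same_card)
  moreover have "card ?S \<in> {0, 2}"
    using mosaic q unfolding corner_mosaic_def vertices_def by (auto simp: mem_Times_iff)
  ultimately show ?thesis by simp
qed

lemma joint_spec:
  assumes "q \<in> vertices"
  shows "joint q \<in> joint_tiles" "edge_endpoints (joint q) = ends q"
proof -
  have "ends q \<subseteq> directions" by (auto simp: ends_def)
  then have "\<exists>\<tau>. \<tau> \<in> joint_tiles \<and> edge_endpoints \<tau> = ends q"
    using obtain_joint_tile[OF _ card_ends[OF assms]] by metis
  then have "joint q \<in> joint_tiles \<and> edge_endpoints (joint q) = ends q"
    unfolding joint_def by (rule someI_ex)
  then show "joint q \<in> joint_tiles" "edge_endpoints (joint q) = ends q" by auto
qed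

lemma end_tile:
  assumes "d \<in> ends q"
  obtains p where "p \<in> tiles" "tile_centre p = vertex_centre q + 2 * d" "- d \<in> edge_endpoints (tile_at p)"
  using assms by (auto simp: ends_def)

lemma end_vertex:
  assumes p: "p \<in> tiles" and d: "d \<in> edge_endpoints (tile_at p)"
  obtains q where "q \<in> vertices" "vertex_centre q = tile_centre p + 2 * d" "- d \<in> ends q"
proof -
  obtain i j where ij: "p = (i, j)" "i < m" "j < n" using p by (auto simp: tiles_def)
  have "\<exists>q\<in>vertices. vertex_centre q = tile_centre p + 2 * d"
  proof -
    have V: "(i, j) \<in> vertices" "(Suc i, j) \<in> vertices" "(i, Suc j) \<in> vertices" "(Suc i, Suc j) \<in> vertices"
      using ij by (auto simp: vertices_def)
    note eqs = tile_centre_eq[OF p, unfolded ij(1)] V[THEN vertex_centre_eq(1)] V[THEN vertex_centre_eq(2)]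
    from d edge_endpoints_subset have "d \<in> directions" by blast
    then consider "d = -1/2" | "d = 1/2" | "d = -\<i>/2" | "d = \<i>/2" by (auto simp: directions_def)
    then show ?thesis
    proof cases
      case 1
      show ?thesis by (rule bexI[OF _ V(3)]) (simp add: 1 eqs complex_eq_iff ij(1))
    next
      case 2
      show ?thesis by (rule bexI[OF _ V(2)]) (simp add: 2 eqs complex_eq_iff ij(1))
    next
      case 3
      show ?thesis by (rule bexI[OF _ V(1)]) (simp add: 3 eqs complex_eq_iff ij(1))
    next
      case 4
      show ?thesis by (rule bexI[OF _ V(4)]) (simp add: 4 eqs complex_eq_iff ij(1))
    qed
  qed
  then obtain q where q: "q \<in> vertices" "vertex_centre q = tile_centre p + 2 * d" by blast
  have "- d \<in> directions" using d edge_endpoints_subset directions_minus by blast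
  then have "- d \<in> ends q" using p d q(2) by (auto simp: ends_def intro!: bexI[of _ p])
  then show ?thesis using that q by blast
qed

lemma edge_grid_tile: "p \<in> tiles \<Longrightarrow> edge_grid (fst (tile_spot p)) (snd (tile_spot p)) = tile_at p"
  unfolding edge_grid_def by (simp add: inv_into_f_f[OF inj_tile_spot])

lemma edge_grid_vertex:
  assumes "q \<in> vertices"
  shows "edge_grid (fst (vertex_spot q)) (snd (vertex_spot q)) = joint q"
proof -
  have "vertex_spot q \<notin> tile_spot ` tiles" using spots_disjoint[OF _ assms] by force
  then show ?thesis
    using assms unfolding edge_grid_def by (simp add: inv_into_f_f[OF inj_vertex_spot])
qed

lemma edge_grid_cases:
  assumes "edge_grid x y \<noteq> T0"
  obtains p where "p \<in> tiles" "(x, y) = tile_spot p" | q where "q \<in> vertices" "(x, y) = vertex_spot q"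
  using assms unfolding edge_grid_def by (auto split: if_splits)

text \<open>Tile spots and vertex spots alternate: across a side where a curve of a tile ends lies a vertex with
  the opposite end, and conversely.\<close>

lemma edge_mosaic_edge_grid: "edge_mosaic grid_size grid_size edge_grid"
  unfolding edge_mosaic_def
proof (intro allI impI ballI)
  fix x y d assume d: "d \<in> edge_endpoints (edge_grid x y)"
  then have d0: "d \<noteq> 0" using edge_endpoints_subset by (fastforce simp: directions_def)
  from d have "edge_grid x y \<noteq> T0" by auto
  then show "\<exists>x'<grid_size. \<exists>y'<grid_size. (x', y') \<noteq> (x, y) \<and>
      (\<exists>e\<in>edge_endpoints (edge_grid x' y'). centre x y + d = centre x' y' + e)"
  proof (cases rule: edge_grid_cases)
    case (1 p)
    then have xy: "x = fst (tile_spot p)" "y = snd (tile_spot p)" by (metis fst_conv snd_conv)+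
    have "d \<in> edge_endpoints (tile_at p)" using d unfolding xy edge_grid_tile[OF 1(1)] .
    then obtain q where q: "q \<in> vertices" "vertex_centre q = tile_centre p + 2 * d" "- d \<in> ends q"
      using end_vertex[OF 1(1)] by blast
    have "vertex_spot q \<in> {..<grid_size} \<times> {..<grid_size}" using spots_in_grid(2) q(1) by blast
    moreover have "vertex_spot q \<noteq> (x, y)" using spots_disjoint[OF 1(1) q(1)] 1(2) by simp
    moreover have "- d \<in> edge_endpoints (edge_grid (fst (vertex_spot q)) (snd (vertex_spot q)))"
      using q(1,3) by (simp add: edge_grid_vertex joint_spec)
    moreover have "centre x y + d = centre (fst (vertex_spot q)) (snd (vertex_spot q)) + - d"
      using q(2) by (simp add: xy tile_centre_def vertex_centre_def)
    ultimately show ?thesis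
      by (intro exI[of _ "fst (vertex_spot q)"] exI[of _ "snd (vertex_spot q)"] conjI bexI[of _ "- d"])
        (auto simp: mem_Times_iff)
  next
    case (2 q)
    then have xy: "x = fst (vertex_spot q)" "y = snd (vertex_spot q)" by (metis fst_conv snd_conv)+
    have "d \<in> ends q" using d unfolding xy edge_grid_vertex[OF 2(1)] joint_spec(2)[OF 2(1)] .
    then obtain p where p: "p \<in> tiles" "tile_centre p = vertex_centre q + 2 * d" "- d \<in> edge_endpoints (tile_at p)"
      by (rule end_tile)
    have "tile_spot p \<in> {..<grid_size} \<times> {..<grid_size}" using spots_in_grid(1) p(1) by blast
    moreover have "tile_spot p \<noteq> (x, y)" using spots_disjoint[OF p(1) 2(1)] 2(2) by simp
    moreover have "- d \<in> edge_endpoints (edge_grid (fst (tile_spot p)) (snd (tile_spot p)))"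
      using p(1,3) by (simp add: edge_grid_tile)
    moreover have "centre x y + d = centre (fst (tile_spot p)) (snd (tile_spot p)) + - d"
      using p(2) by (simp add: xy tile_centre_def vertex_centre_def)
    ultimately show ?thesis
      by (intro exI[of _ "fst (tile_spot p)"] exI[of _ "snd (tile_spot p)"] conjI bexI[of _ "- d"])
        (auto simp: mem_Times_iff)
  qed
qed

lemma edge_curves:
  "mosaic_curves edge_pattern grid_size grid_size edge_grid =
     (\<Union>p\<in>tiles. place (tile_centre p) ` edge_pattern (tile_at p)) \<union>
     (\<Union>q\<in>vertices. place (vertex_centre q) ` edge_pattern (joint q))"
proof -
  let ?F = "\<lambda>s. place (centre (fst s) (snd s)) ` edge_pattern (edge_grid (fst s) (snd s))"
  have empty: "?F s = {}" if "s \<notin> tile_spot ` tiles" "s \<notin> vertex_spot ` vertices" for s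
    using that by (simp add: edge_grid_def)
  have "mosaic_curves edge_pattern grid_size grid_size edge_grid = (\<Union>s\<in>{..<grid_size} \<times> {..<grid_size}. ?F s)"
    by (rule mosaic_curves_eq)
  also have "\<dots> = (\<Union>s\<in>tile_spot ` tiles \<union> vertex_spot ` vertices. ?F s)"
    by (rule UN_restrict[OF Un_least[OF spots_in_grid]]) (use empty in blast)
  also have "\<dots> = (\<Union>p\<in>tiles. ?F (tile_spot p)) \<union> (\<Union>q\<in>vertices. ?F (vertex_spot q))"
    by (simp only: UN_Un image_image)
  also have "(\<Union>p\<in>tiles. ?F (tile_spot p)) = (\<Union>p\<in>tiles. place (tile_centre p) ` edge_pattern (tile_at p))"
    by (intro SUP_cong refl) (simp add: edge_grid_tile tile_centre_def)
  also have "(\<Union>q\<in>vertices. ?F (vertex_spot q)) = (\<Union>q\<in>vertices. place (vertex_centre q) ` edge_pattern (joint q))"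
    by (intro SUP_cong refl) (simp add: edge_grid_vertex vertex_centre_def)
  finally show ?thesis .
qed

lemma rotated_corner_curves:
  "(\<lambda>(z, h). ((1 + \<i>) * z + (of_nat n + \<i>), h)) ` mosaic_curves corner_pattern m n M =
     (\<Union>p\<in>tiles. place (tile_centre p) ` double ` edge_pattern (tile_at p))"
proof -
  have "(1 + \<i>) * ((1 - \<i>) * z) = 2 * z" for z by (simp add: algebra_simps)
  then have "(\<lambda>(z, h). ((1 + \<i>) * z + (of_nat n + \<i>), h)) ` place (centre (fst p) (snd p)) ` corner_pattern (tile_at p)
      = place (tile_centre p) ` double ` edge_pattern (tile_at p)" if "p \<in> tiles" for p
    unfolding tile_centre_rotation[OF that] corner_pattern_def image_image
    by (intro image_cong refl) (simp add: place_def double_def case_prod_unfold distrib_left)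
  then show ?thesis
    unfolding mosaic_curves_eq image_UN tile_at_def[symmetric] tiles_def[symmetric] by (rule SUP_cong[OF refl])
qed

text \<open>The stub of a tile that points to a vertex is the spoke of this vertex that points back.\<close>

lemma stubs_eq_spokes:
  "(\<Union>p\<in>tiles. \<Union>d\<in>edge_endpoints (tile_at p). place (tile_centre p) ` stub d) =
     (\<Union>q\<in>vertices. \<Union>d\<in>ends q. place (vertex_centre q) ` spoke d)"
proof -
  have eq: "place (tile_centre p) ` stub d = place (vertex_centre q) ` spoke (- d)"
    if "vertex_centre q = tile_centre p + 2 * d" for p q d
    unfolding stub_def spoke_def place_segment that by (simp add: closed_segment_commute add.commute)
  show ?thesis
  proof (intro subset_antisym subsetI)
    fix x assume "x \<in> (\<Union>p\<in>tiles. \<Union>d\<in>edge_endpoints (tile_at p). place (tile_centre p) ` stub d)"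
    then obtain p d where p: "p \<in> tiles" "d \<in> edge_endpoints (tile_at p)" "x \<in> place (tile_centre p) ` stub d"
      by blast
    obtain q where q: "q \<in> vertices" "vertex_centre q = tile_centre p + 2 * d" "- d \<in> ends q"
      using end_vertex[OF p(1,2)] .
    from eq[OF q(2)] have "x \<in> place (vertex_centre q) ` spoke (- d)" using p(3) by simp
    then show "x \<in> (\<Union>q\<in>vertices. \<Union>d\<in>ends q. place (vertex_centre q) ` spoke d)"
      using q(1,3) by blast
  next
    fix x assume "x \<in> (\<Union>q\<in>vertices. \<Union>d\<in>ends q. place (vertex_centre q) ` spoke d)"
    then obtain q d where q: "q \<in> vertices" "d \<in> ends q" "x \<in> place (vertex_centre q) ` spoke d"
      by blast
    obtain p where p: "p \<in> tiles" "tile_centre p = vertex_centre q + 2 * d" "- d \<in> edge_endpoints (tile_at p)"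
      using end_tile[OF q(2)] .
    have "vertex_centre q = tile_centre p + 2 * - d" unfolding p(2) by simp
    from eq[OF this] have "x \<in> place (tile_centre p) ` stub (- d)" using q(3) by simp
    then show "x \<in> (\<Union>p\<in>tiles. \<Union>d\<in>edge_endpoints (tile_at p). place (tile_centre p) ` stub d)"
      using p(1,3) by blast
  qed
qed

text \<open>In the sum norm, the centres of distinct tiles have distance at least 2.\<close>

lemma diamonds_disjoint:
  assumes "p \<in> tiles" "p' \<in> tiles" "p \<noteq> p'"
  shows "place (tile_centre p) ` closed_diamond \<inter> place (tile_centre p') ` open_diamond = {}"
proof -
  have False if eq: "tile_centre p + z = tile_centre p' + z'"
    and "\<bar>Re z\<bar> + \<bar>Im z\<bar> \<le> 1" "\<bar>Re z'\<bar> + \<bar>Im z'\<bar> < 1" for z z'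
  proof -
    define a where "a = real (fst p) - real (fst p')"
    define b where "b = real (snd p) - real (snd p')"
    have "a - b = Re z' - Re z" "a + b = Im z' - Im z"
      using arg_cong[OF eq, of Re] arg_cong[OF eq, of Im]
      by (simp_all add: tile_centre_eq[OF assms(1)] tile_centre_eq[OF assms(2)] a_def b_def)
    then have "\<bar>a - b\<bar> + \<bar>a + b\<bar> < 2"
      using that(2,3) abs_triangle_ineq4[of "Re z'" "Re z"] abs_triangle_ineq4[of "Im z'" "Im z"] by simp
    then have "\<bar>a\<bar> < 1" "\<bar>b\<bar> < 1" by linarith+
    then have "fst p = fst p'" "snd p = snd p'" unfolding a_def b_def by linarith+
    then show False using assms(3) by (simp add: prod_eq_iff)
  qed
  then show ?thesis unfolding place_def closed_diamond_def open_diamond_def by fastforce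
qed

section \<open>The two mosaics represent the same link\<close>

text \<open>Each joint tile is moved within the open square about its vertex, which meets no other square.\<close>

lemma supported_move_joints:
  defines "Z \<equiv> \<Union>p\<in>tiles. place (tile_centre p) ` edge_pattern (tile_at p)"
  shows "supported_move UNIV
     (Z \<union> (\<Union>q\<in>vertices. place (vertex_centre q) ` (\<Union>d\<in>ends q. spoke d)))
     (Z \<union> (\<Union>q\<in>vertices. place (vertex_centre q) ` edge_pattern (joint q)))"
proof -
  have "supported_move (\<Union>q\<in>vertices. place (vertex_centre q) ` open_square)
     (Z \<union> (\<Union>q\<in>vertices. place (vertex_centre q) ` (\<Union>d\<in>ends q. spoke d)))
     (Z \<union> (\<Union>q\<in>vertices. place (vertex_centre q) ` edge_pattern (joint q)))"
  proof (rule supported_move_UN[OF finite_vertices])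
    fix q assume q: "q \<in> vertices"
    show "supported_move (place (vertex_centre q) ` open_square)
        (place (vertex_centre q) ` (\<Union>d\<in>ends q. spoke d)) (place (vertex_centre q) ` edge_pattern (joint q))"
      using supported_move_place[OF supported_move_joint[OF joint_spec(1)[OF q]]] unfolding joint_spec(2)[OF q] .
    have "place (tile_centre p) ` closed_square \<inter> place (vertex_centre q) ` open_square = {}" if "p \<in> tiles" for p
      using squares_disjoint centres_distinct[OF that q] unfolding tile_centre_def vertex_centre_def by blast
    then show "Z \<inter> place (vertex_centre q) ` open_square = {}"
      unfolding Z_def using edge_pattern_subset by blast
    fix q' assume q': "q' \<in> vertices" "q \<noteq> q'"
    have "vertex_centre q' \<noteq> vertex_centre q" using inj_vertex_centre q q' by (auto simp: inj_on_def)
    then have "place (vertex_centre q') ` closed_square \<inter> place (vertex_centre q) ` open_square = {}"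
      using squares_disjoint unfolding vertex_centre_def by blast
    moreover have "(\<Union>d\<in>ends q'. spoke d) \<subseteq> closed_square" using spoke_subset by (auto simp: ends_def)
    ultimately show "place (vertex_centre q') ` (\<Union>d\<in>ends q'. spoke d) \<inter> place (vertex_centre q) ` open_square = {} \<and>
        place (vertex_centre q') ` edge_pattern (joint q') \<inter> place (vertex_centre q) ` open_square = {}"
      using edge_pattern_subset by blast
  qed
  then show ?thesis by (rule supported_move_mono) simp
qed

lemma supported_move_tiles:
  "supported_move UNIV
     (\<Union>p\<in>tiles. place (tile_centre p) ` with_stubs (tile_at p))
     (\<Union>p\<in>tiles. place (tile_centre p) ` double ` edge_pattern (tile_at p))"
proof -
  have "supported_move (\<Union>p\<in>tiles. place (tile_centre p) ` open_diamond)
     ({} \<union> (\<Union>p\<in>tiles. place (tile_centre p) ` with_stubs (tile_at p)))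
     ({} \<union> (\<Union>p\<in>tiles. place (tile_centre p) ` double ` edge_pattern (tile_at p)))"
  proof (rule supported_move_UN[OF finite_tiles])
    fix p assume p: "p \<in> tiles"
    show "supported_move (place (tile_centre p) ` open_diamond)
        (place (tile_centre p) ` with_stubs (tile_at p)) (place (tile_centre p) ` double ` edge_pattern (tile_at p))"
      by (rule supported_move_place[OF supported_move_tile])
    fix p' assume p': "p' \<in> tiles" "p \<noteq> p'"
    show "place (tile_centre p') ` with_stubs (tile_at p') \<inter> place (tile_centre p) ` open_diamond = {} \<and>
        place (tile_centre p') ` double ` edge_pattern (tile_at p') \<inter> place (tile_centre p) ` open_diamond = {}"
      using diamonds_disjoint[OF p'(1) p] p'(2) with_stubs_subset double_edge_pattern_subset by blast
  qed simp
  then show ?thesis by (simp add: supported_move_mono)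
qed

text \<open>The curves of both mosaics are compared with the patterns prolonged by stubs: at the vertices the
  joint tiles are straightened to pairs of spokes, which are the stubs of the adjacent tiles, and
  then every prolonged pattern expands to its doubled copy.\<close>

lemma edge_curves_isotopic:
  "ambient_isotopic (stereo_inv ` mosaic_curves edge_pattern grid_size grid_size edge_grid)
     (stereo_inv ` mosaic_curves corner_pattern m n M)"
proof -
  let ?Z = "\<Union>p\<in>tiles. place (tile_centre p) ` edge_pattern (tile_at p)"
  let ?a = "1 + \<i>" and ?b = "of_nat n + \<i>"
  let ?R = "(\<lambda>(z, h :: real). (?a * z + ?b, h)) ` mosaic_curves corner_pattern m n M"
  have "?Z \<union> (\<Union>q\<in>vertices. place (vertex_centre q) ` (\<Union>d\<in>ends q. spoke d))
      = (\<Union>p\<in>tiles. place (tile_centre p) ` with_stubs (tile_at p))"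
    unfolding image_UN stubs_eq_spokes[symmetric] with_stubs_def image_Un by blast
  then have "supported_move UNIV (mosaic_curves edge_pattern grid_size grid_size edge_grid) ?R"
    using supported_move_trans[OF supported_move_sym[OF supported_move_joints]] supported_move_tiles
    unfolding edge_curves rotated_corner_curves by simp
  then have "ambient_isotopic (stereo_inv ` mosaic_curves edge_pattern grid_size grid_size edge_grid) (stereo_inv ` ?R)"
    by (rule ambient_isotopic_of_supported_move)
  moreover have "ambient_isotopic (stereo_inv ` ?R) (stereo_inv ` mosaic_curves corner_pattern m n M)"
    by (rule ambient_isotopic_affine_inverse) (simp add: complex_eq_iff)
  ultimately show ?thesis by (rule ambient_isotopic_trans)
qed

section \<open>Counting tiles\<close>

definition support :: "(nat \<times> nat) set" where
  "support = {p \<in> tiles. tile_at p \<noteq> T0}"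

definition joints :: "(nat \<times> nat) set" where
  "joints = {q \<in> vertices. ends q \<noteq> {}}"

lemma finite_support: "finite support" and finite_joints: "finite joints"
  using finite_tiles finite_vertices by (auto simp: support_def joints_def)

lemma tile_count_corner: "tile_count m n M = card support"
  unfolding tile_count_def support_def tiles_def tile_at_def by (rule arg_cong[of _ _ card]) auto

lemma tile_count_edge: "tile_count grid_size grid_size edge_grid = card support + card joints"
proof -
  have J: "joint q \<noteq> T0 \<longleftrightarrow> ends q \<noteq> {}" if "q \<in> vertices" for q
    using joint_spec(2)[OF that] edge_endpoints_empty_iff[of "joint q"] by simp
  have "{(x, y). x < grid_size \<and> y < grid_size \<and> edge_grid x y \<noteq> T0} = tile_spot ` support \<union> vertex_spot ` joints"
  proof (intro subset_antisym subsetI)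
    fix s assume s: "s \<in> {(x, y). x < grid_size \<and> y < grid_size \<and> edge_grid x y \<noteq> T0}"
    obtain x y where xy: "s = (x, y)" by fastforce
    then have ne: "edge_grid x y \<noteq> T0" using s by simp
    then show "s \<in> tile_spot ` support \<union> vertex_spot ` joints"
    proof (cases rule: edge_grid_cases)
      case (1 p)
      then have "tile_at p \<noteq> T0" using ne edge_grid_tile[OF 1(1)] by (metis fst_conv snd_conv)
      then show ?thesis using 1 xy by (auto simp: support_def)
    next
      case (2 q)
      then have "joint q \<noteq> T0" using ne edge_grid_vertex[OF 2(1)] by (metis fst_conv snd_conv)
      then show ?thesis using 2 xy J[OF 2(1)] by (auto simp: joints_def)
    qed
  next
    fix s assume s: "s \<in> tile_spot ` support \<union> vertex_spot ` joints"
    then have "s \<in> {..<grid_size} \<times> {..<grid_size}" using spots_in_grid by (auto simp: support_def joints_def)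
    moreover have "edge_grid (fst s) (snd s) \<noteq> T0"
      using s edge_grid_tile edge_grid_vertex J by (auto simp: support_def joints_def)
    ultimately show "s \<in> {(x, y). x < grid_size \<and> y < grid_size \<and> edge_grid x y \<noteq> T0}" by auto
  qed
  moreover have "card (tile_spot ` support \<union> vertex_spot ` joints) = card support + card joints"
  proof (subst card_Un_disjoint)
    show "tile_spot ` support \<inter> vertex_spot ` joints = {}"
      using spots_disjoint by (force simp: support_def joints_def)
    have "card (tile_spot ` support) = card support"
      by (rule card_image, rule inj_on_subset[OF inj_tile_spot]) (auto simp: support_def)
    moreover have "card (vertex_spot ` joints) = card joints"
      by (rule card_image, rule inj_on_subset[OF inj_vertex_spot]) (auto simp: joints_def)
    ultimately show "card (tile_spot ` support) + card (vertex_spot ` joints) = card support + card joints" by simp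
  qed (use finite_support finite_joints in auto)
  ultimately show ?thesis unfolding tile_count_def by simp
qed

text \<open>Each joint has two ends, and each of them is an endpoint of a curve on one of the tiles.\<close>

lemma twice_joints_le: "2 * card joints \<le> (\<Sum>p\<in>support. card (edge_endpoints (tile_at p)))"
proof -
  let ?A = "SIGMA p:support. edge_endpoints (tile_at p)"
  let ?B = "SIGMA q:joints. ends q"
  have two: "card (ends q) = 2" "finite (ends q)" if "q \<in> joints" for q
  proof -
    have "finite (ends q)" by (rule finite_subset[of _ directions]) (auto simp: ends_def directions_def)
    then show "card (ends q) = 2" "finite (ends q)"
      using card_ends[of q] that by (auto simp: joints_def)
  qed
  \<comment> \<open>The end \<open>d\<close> at \<open>q\<close> comes from the endpoint \<open>- d\<close> of the tile across it, which determines \<open>q\<close>.\<close>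
  have "?B \<subseteq> (\<lambda>(p, d). (inv_into vertices vertex_centre (tile_centre p + 2 * d), - d)) ` ?A"
  proof
    fix s assume "s \<in> ?B"
    then obtain q d where s: "s = (q, d)" "q \<in> vertices" "d \<in> ends q" by (auto simp: joints_def)
    obtain p where p: "p \<in> tiles" "tile_centre p = vertex_centre q + 2 * d" "- d \<in> edge_endpoints (tile_at p)"
      using end_tile[OF s(3)] .
    have "(p, - d) \<in> ?A" using p by (auto simp: support_def)
    moreover have "s = (inv_into vertices vertex_centre (tile_centre p + 2 * - d), - (- d))"
      using p(2) s(1,2) inj_vertex_centre by simp
    ultimately show "s \<in> (\<lambda>(p, d). (inv_into vertices vertex_centre (tile_centre p + 2 * d), - d)) ` ?A"
      by (intro image_eqI[where x = "(p, - d)"]) simp_all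
  qed
  then have "card ?B \<le> card ?A"
    by (rule surj_card_le[rotated]) (auto intro!: finite_SigmaI finite_support finite_edge_endpoints)
  moreover have "card ?A = (\<Sum>p\<in>support. card (edge_endpoints (tile_at p)))"
    by (rule card_SigmaI) (auto simp: finite_support finite_edge_endpoints)
  moreover have "card ?B = (\<Sum>q\<in>joints. card (ends q))"
    by (rule card_SigmaI) (auto simp: finite_joints two)
  moreover have "(\<Sum>q\<in>joints. card (ends q)) = 2 * card joints"
    using two by simp
  ultimately show ?thesis by simp
qed

text \<open>The other curve that ends at the same vertex lies on another tile, seen from the vertex in another
  direction.\<close>

lemma other_tile:
  assumes "p \<in> tiles" "d \<in> edge_endpoints (tile_at p)"
  obtains p' e where "p' \<in> support" "e \<in> directions" "e \<noteq> - d" "tile_centre p' = tile_centre p + 2 * d + 2 * e"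
proof -
  obtain q where q: "q \<in> vertices" "vertex_centre q = tile_centre p + 2 * d" "- d \<in> ends q"
    using end_vertex[OF assms] .
  have "finite (ends q)" by (rule finite_subset[of _ directions]) (auto simp: ends_def directions_def)
  then have "card (ends q) = 2"
    using card_ends[OF q(1)] q(3) by auto
  then obtain e where e: "e \<in> ends q" "e \<noteq> - d" by (auto simp: card_2_iff)
  obtain p' where p': "p' \<in> tiles" "tile_centre p' = vertex_centre q + 2 * e" "- e \<in> edge_endpoints (tile_at p')"
    using end_tile[OF e(1)] .
  then have "p' \<in> support" by (auto simp: support_def)
  moreover have "e \<in> directions" using e(1) by (simp add: ends_def)
  moreover have "tile_centre p' = tile_centre p + 2 * d + 2 * e" using p'(2) q(2) by simp
  ultimately show ?thesis using that e(2) by blast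
qed

text \<open>The position of a tile when the rows are read from bottom to top, and each row from left to right.\<close>

definition scan :: "nat \<times> nat \<Rightarrow> nat" where
  "scan p = snd p * m + fst p"

lemma inj_scan: "inj_on scan tiles"
proof (rule inj_onI)
  have *: "scan r div m = snd r \<and> scan r mod m = fst r" if "r \<in> tiles" for r
    using that by (auto simp: scan_def tiles_def)
  fix p p' assume "p \<in> tiles" "p' \<in> tiles" "scan p = scan p'"
  then show "p = p'" using *[of p] *[of p'] by (simp add: prod_eq_iff)
qed

text \<open>The direction \<open>\<i>/2\<close> of the rotated picture points to the upper right corner of a corner tile,
  and the three other tiles at this corner come later in the scan.\<close>

lemma last_tile_misses_top:
  assumes "p \<in> support" "\<And>p'. p' \<in> support \<Longrightarrow> scan p' \<le> scan p"
  shows "\<i>/2 \<notin> edge_endpoints (tile_at p)"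
proof
  assume miss: "\<i>/2 \<in> edge_endpoints (tile_at p)"
  have p: "p \<in> tiles" using assms(1) by (simp add: support_def)
  obtain p' e where p': "p' \<in> support" "e \<in> directions" "e \<noteq> - (\<i>/2)"
    "tile_centre p' = tile_centre p + 2 * (\<i>/2) + 2 * e"
    using other_tile[OF p miss] .
  have t': "p' \<in> tiles" using p'(1) by (simp add: support_def)
  have m: "m > 0" using p by (auto simp: tiles_def)
  have eqs: "real (fst p') - real (snd p') = real (fst p) - real (snd p) + 2 * Re e"
    "real (fst p') + real (snd p') = real (fst p) + real (snd p) + 1 + 2 * Im e"
    using arg_cong[OF p'(4), of Re] arg_cong[OF p'(4), of Im]
    by (simp_all add: tile_centre_eq[OF p] tile_centre_eq[OF t'])
  have "e = -1/2 \<or> e = 1/2 \<or> e = \<i>/2" using p'(2,3) by (auto simp: directions_def)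
  then have "Re e = -1/2 \<and> Im e = 0 \<or> Re e = 1/2 \<and> Im e = 0 \<or> Re e = 0 \<and> Im e = 1/2"
    by (elim disjE) (hypsubst, simp)+
  then consider "Re e = -1/2" "Im e = 0" | "Re e = 1/2" "Im e = 0" | "Re e = 0" "Im e = 1/2"
    by blast
  then have "fst p' = fst p \<and> snd p' = snd p + 1 \<or> fst p' = fst p + 1 \<and> snd p' = snd p \<or>
      fst p' = fst p + 1 \<and> snd p' = snd p + 1"
  proof cases
    case 1
    then have "fst p' = fst p" "snd p' = snd p + 1" using eqs by linarith+
    then show ?thesis by simp
  next
    case 2
    then have "fst p' = fst p + 1" "snd p' = snd p" using eqs by linarith+
    then show ?thesis by simp
  next
    case 3
    then have "fst p' = fst p + 1" "snd p' = snd p + 1" using eqs by linarith+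
    then show ?thesis by simp
  qed
  then have "scan p' > scan p" using m by (auto simp: scan_def)
  then show False using assms(2)[OF p'(1)] by simp
qed

lemma first_tile_misses_bottom:
  assumes "p \<in> support" "\<And>p'. p' \<in> support \<Longrightarrow> scan p \<le> scan p'"
  shows "-\<i>/2 \<notin> edge_endpoints (tile_at p)"
proof
  assume miss: "-\<i>/2 \<in> edge_endpoints (tile_at p)"
  have p: "p \<in> tiles" using assms(1) by (simp add: support_def)
  obtain p' e where p': "p' \<in> support" "e \<in> directions" "e \<noteq> - (-\<i>/2)"
    "tile_centre p' = tile_centre p + 2 * (-\<i>/2) + 2 * e"
    using other_tile[OF p miss] .
  have t': "p' \<in> tiles" using p'(1) by (simp add: support_def)
  have m: "m > 0" using p by (auto simp: tiles_def)
  have eqs: "real (fst p') - real (snd p') = real (fst p) - real (snd p) + 2 * Re e"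
    "real (fst p') + real (snd p') = real (fst p) + real (snd p) - 1 + 2 * Im e"
    using arg_cong[OF p'(4), of Re] arg_cong[OF p'(4), of Im]
    by (simp_all add: tile_centre_eq[OF p] tile_centre_eq[OF t'])
  have "e = -1/2 \<or> e = 1/2 \<or> e = -\<i>/2" using p'(2,3) by (auto simp: directions_def)
  then have "Re e = -1/2 \<and> Im e = 0 \<or> Re e = 1/2 \<and> Im e = 0 \<or> Re e = 0 \<and> Im e = -1/2"
    by (elim disjE) (hypsubst, simp)+
  then consider "Re e = -1/2" "Im e = 0" | "Re e = 1/2" "Im e = 0" | "Re e = 0" "Im e = -1/2"
    by blast
  then have "fst p = fst p' \<and> snd p = snd p' + 1 \<or> fst p = fst p' + 1 \<and> snd p = snd p' \<or>
      fst p = fst p' + 1 \<and> snd p = snd p' + 1"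
  proof cases
    case 1
    then have "fst p = fst p' + 1" "snd p = snd p'" using eqs by linarith+
    then show ?thesis by simp
  next
    case 2
    then have "fst p = fst p'" "snd p = snd p' + 1" using eqs by linarith+
    then show ?thesis by simp
  next
    case 3
    then have "fst p = fst p' + 1" "snd p = snd p' + 1" using eqs by linarith+
    then show ?thesis by simp
  qed
  then have "scan p' < scan p" using m by (auto simp: scan_def)
  then show False using assms(2)[OF p'(1)] by simp
qed

text \<open>The last and the first tile of the scan have only two endpoints each. They are distinct: a single
  nonempty tile could not be continued at its endpoints.\<close>

lemma sum_endpoints_le:
  assumes "support \<noteq> {}"
  shows "(\<Sum>p\<in>support. card (edge_endpoints (tile_at p))) + 4 \<le> 4 * card support"
proof -
  have ne: "scan ` support \<noteq> {}" "finite (scan ` support)" using assms finite_support by auto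
  obtain p where p: "p \<in> support" "scan p = Max (scan ` support)" using Max_in[OF ne(2,1)] by auto
  obtain q where q: "q \<in> support" "scan q = Min (scan ` support)" using Min_in[OF ne(2,1)] by auto
  have max: "scan p' \<le> scan p" and min: "scan q \<le> scan p'" if "p' \<in> support" for p'
    using p(2) q(2) that ne by auto
  have "p \<noteq> q"
  proof
    assume "p = q"
    then have eq: "p' = p" if "p' \<in> support" for p'
      using max[OF that] min[OF that] inj_onD[OF inj_scan, of p' p] that p(1) by (auto simp: support_def)
    obtain d where d: "d \<in> edge_endpoints (tile_at p)"
      using p(1) edge_endpoints_empty_iff by (auto simp: support_def)
    have "p \<in> tiles" using p(1) by (simp add: support_def)
    then obtain p' e where "p' \<in> support" "e \<in> directions" "e \<noteq> - d"
      "tile_centre p' = tile_centre p + 2 * d + 2 * e"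
      using other_tile[OF _ d] by blast
    then have "2 * d + 2 * e = 0" using eq by auto
    then have "e + d = 0" by (metis add.commute distrib_left mult_eq_0_iff zero_neq_numeral)
    then show False using \<open>e \<noteq> - d\<close> by (simp add: eq_neg_iff_add_eq_0)
  qed
  have "card (edge_endpoints (tile_at p)) \<le> 2"
    by (rule card_edge_endpoints_le_2[OF _ last_tile_misses_top[OF p(1) max]]) (simp_all add: directions_def)
  moreover have "card (edge_endpoints (tile_at q)) \<le> 2"
    by (rule card_edge_endpoints_le_2[OF _ first_tile_misses_bottom[OF q(1) min]]) (simp_all add: directions_def)
  moreover have "(\<Sum>p\<in>support - {p, q}. card (edge_endpoints (tile_at p))) \<le> 4 * card (support - {p, q})"
    using sum_bounded_above[of "support - {p, q}" "\<lambda>p. card (edge_endpoints (tile_at p))" 4]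
      card_edge_endpoints_le by simp
  moreover have "(\<Sum>p\<in>support. card (edge_endpoints (tile_at p)))
      = (\<Sum>p\<in>support - {p, q}. card (edge_endpoints (tile_at p))) + (\<Sum>p\<in>{p, q}. card (edge_endpoints (tile_at p)))"
    by (rule sum.subset_diff) (use p q finite_support in auto)
  moreover have "card support = card (support - {p, q}) + 2"
  proof -
    have "card support = card (support - {p, q}) + card {p, q}"
      using card_Diff_subset[of "{p, q}" support] card_mono[of support "{p, q}"] p(1) q(1) finite_support by simp
    then show ?thesis using \<open>p \<noteq> q\<close> by simp
  qed
  ultimately show ?thesis using \<open>p \<noteq> q\<close> by simp
qed

lemma tile_count_bound:
  assumes "tile_count m n M \<noteq> 0"
  shows "tile_count grid_size grid_size edge_grid + 2 \<le> 3 * tile_count m n M"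
proof -
  have "support \<noteq> {}" using assms tile_count_corner by auto
  from twice_joints_le sum_endpoints_le[OF this]
  show ?thesis unfolding tile_count_edge tile_count_corner by linarith
qed

end

section \<open>Comparison of the tile numbers\<close>

lemma link_nonempty: "link L \<Longrightarrow> L \<noteq> {}"
proof
  assume "link L" "L = {}"
  then obtain \<K> where \<K>: "\<K> \<noteq> {}" "L = \<Union>\<K>" "\<forall>K\<in>\<K>. K homeomorphic sphere (0 :: complex) 1"
    unfolding link_def by blast
  from \<K>(1) obtain K where K: "K \<in> \<K>" by (meson ex_in_conv)
  then have "K = {}" using \<K>(2) \<open>L = {}\<close> by simp
  moreover have "K homeomorphic sphere (0 :: complex) 1" using \<K>(3) K by (rule bspec)
  ultimately show False by (simp add: homeomorphic_empty)
qed

text \<open>A link is nonempty, so a mosaic that represents it has a nonempty tile.\<close>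

lemma tile_count_nonzero:
  assumes "link L" "ambient_isotopic (stereo_inv ` mosaic_curves corner_pattern m n M) L"
  shows "tile_count m n M \<noteq> 0"
proof
  have "finite {(i, j). i < m \<and> j < n \<and> M i j \<noteq> T0}"
    by (rule finite_subset[of _ "{..<m} \<times> {..<n}"]) auto
  moreover assume "tile_count m n M = 0"
  ultimately have "M i j = T0" if "i < m" "j < n" for i j
    using that by (auto simp: tile_count_def)
  then have "mosaic_curves corner_pattern m n M = {}"
    by (simp add: mosaic_curves_def corner_pattern_def)
  then have "L = {}" using assms(2) by (auto simp: ambient_isotopic_def)
  then show False using link_nonempty[OF assms(1)] by simp
qed

theorem corollary2p1:
  fixes L :: "(complex \<times> complex) set"
  assumes "link L"
  shows "3 * ereal_of_enat (corner_tile_number L) - 2 \<ge> ereal_of_enat (edge_tile_number L)"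
proof -
  let ?S = "{enat (tile_count m n M) | m n M. corner_mosaic m n M \<and>
    ambient_isotopic (stereo_inv ` mosaic_curves corner_pattern m n M) L}"
  show ?thesis
  proof (cases "?S = {}")
    case True
    then have "corner_tile_number L = \<infinity>"
      unfolding corner_tile_number_def by (simp add: Inf_enat_def)
    then show ?thesis by simp
  next
    case False
    then have "corner_tile_number L \<in> ?S"
      unfolding corner_tile_number_def Inf_enat_def by (simp only: if_False) (metis (mono_tags, lifting) LeastI equals0I)
    then obtain m n M where M: "corner_tile_number L = enat (tile_count m n M)" "corner_mosaic m n M"
      "ambient_isotopic (stereo_inv ` mosaic_curves corner_pattern m n M) L" by blast
    interpret corner_diagram m n M by unfold_locales (rule M(2))
    have "edge_tile_number L \<le> enat (tile_count grid_size grid_size edge_grid)"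
      unfolding edge_tile_number_def
      using edge_mosaic_edge_grid ambient_isotopic_trans[OF edge_curves_isotopic M(3)]
      by (intro Inf_lower) blast
    then have "ereal_of_enat (edge_tile_number L) \<le> ereal_of_enat (enat (tile_count grid_size grid_size edge_grid))"
      by (simp only: ereal_of_enat_le_iff)
    also have "\<dots> \<le> ereal (3 * real (tile_count m n M) - 2)"
      using tile_count_bound[OF tile_count_nonzero[OF assms M(3)]] by simp
    also have "\<dots> = 3 * ereal_of_enat (corner_tile_number L) - 2"
      by (simp add: M(1))
    finally show ?thesis .
  qed
qed

end
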